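(* Let $[A],[B]\in\hat V$ be main separated with $\operatorname{supp}(A),\operatorname{supp}(B)\subseteq P^\circ$. Suppose further that $[A]$ is a core character, and that $\Psi_A$ and $\Psi_B$ coincide on $\operatorname{Stab}_U(A,B)$. Then there exists $g\in U_{I(A)}\le U$ such that $g.[B]=[A]$.
   Context: Let $q$ be a power of an odd prime $p$, $n$ a positive integer, and fix a Lie type $\mathfrak B_n$, $\mathfrak C_n$ or $\mathfrak D_n$. Put $N=2n+1$ in type $\mathfrak B_n$, $N=2n$ in types $\mathfrak C_n,\mathfrak D_n$; $\tilde n=n+1$ in type $\mathfrak B_n$, $\tilde n=n$ otherwise; $\bar i=N+1-i$ for $1\le i\le N$. Let $P^\circ=\{(i,j):1\le i<j<\bar i\}$, $\Gamma=\{(i,\bar i):1\le i<\bar i\}$; $P=P^\circ$ in types $\mathfrak B_n,\mathfrak D_n$ and $P=P^\circ\cup\Gamma$ in type $\mathfrak C_n$. $V$ is the space of $N\times N$-matrices over $\mathbb F_q$ whose support $\operatorname{supp}$ lies in $P$; $\pi$ is the map from $N\times N$-matrices onto $V$ replacing entries outside $P$ by zero. $\widetilde U$ is the group of upper unitriangular $N\times N$-matrices over $\mathbb F_q$; $e_{ij}$ are the matrix units. For $(i,j)\in P$, $\alpha\in\mathbb F_q$ define $x_{ij}(\alpha)$: in type $\mathfrak D_n$, and in type $\mathfrak B_n$ if $j\ne n+1$: $1+\alpha e_{ij}-\alpha e_{\bar j\,\bar i}$; in type $\mathfrak B_n$, $j=n+1$: $1+\alpha e_{i,n+1}-\alpha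 e_{n+1,\bar i}-\frac12\alpha^2e_{i\bar i}$; in type $\mathfrak C_n$: $1+\alpha e_{ij}-\alpha e_{\bar j\,\bar i}$ if $j\le n$, $1+\alpha e_{ij}+\alpha e_{\bar j\,\bar i}$ if $n<j<\bar i$, and $1+\alpha e_{i\bar i}$ if $j=\bar i$. $X_{ij}=\{x_{ij}(\alpha):\alpha\in\mathbb F_q\}$ and $U\le\widetilde U$ is the group generated by all $X_{ij}$, $(i,j)\in P$. Fix a nontrivial linear character $\theta:(\mathbb F_q,+)\to\mathbb C^*$ and put $\kappa(A,B)=\operatorname{tr}(A^tB)$. For $A\in V$ let $[A]$ be the linear character $B\mapsto\theta(\kappa(-A,B))$ of $(V,+)$; $\hat V=\{[A]:A\in V\}$. With $g^{-t}$ the inverse transpose, $U$ acts on $\hat V$ from the right by $[A].g=[\pi(Ag^{-t})]$ and from the left by $g.[A]=[\pi(g^{-t}A)]$. $\operatorname{Stab}_U[A]=\{u\in U:[A].u=[A]\}$ (right action), $\operatorname{Stab}_U(A,B)=\operatorname{Stab}_U[A]\cap\operatorname{Stab}_U[B]$, and $\Psi_A:\operatorname{Stab}_U[A]\to\mathbb C^*$ is the linear character $\Psi_A(u)=\theta(\kappa(-A,\pi(u^{-1})))$. For $A\in V$, $\operatorname{main}(A)$ is the set of $(i,j)\in P$ such that $A_{ij}$ is the rightmost nonzero entry of row $i$; it is called a left main condition if $j\le\tilde n$ and a right main condition if $j>\tilde n$; $\operatorname{r.main}(A)$ is the set of right main conditions. $[A]$ is staircase if its main conditions lie in pairwise different columns.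 For staircase $[A]$: minor conditions are the positions $(i,\bar j)$ with $(i,j)\in\operatorname{r.main}(A)$, forming $\operatorname{minor}(A)$; $\operatorname{suppl}(A)$ is the set of $(i,j)\in P$ with $j\le\tilde n$ which lie (in the same row) to the left of some minor condition or some left main condition, lie in the same column as some minor condition, and are neither minor nor main conditions. $\operatorname{core}(A)=\operatorname{main}(A)\cup\operatorname{minor}(A)\cup\operatorname{suppl}(A)$ in types $\mathfrak B_n,\mathfrak D_n$ and $\operatorname{core}(A)=\operatorname{main}(A)\cup\operatorname{suppl}(A)$ in type $\mathfrak C_n$. A staircase $[A]$ is a core character if $\operatorname{main}(A)\subseteq\operatorname{supp}(A)\subseteq\operatorname{core}(A)$. For $(i,j)\in P$ set $\mathcal A(i,j)=\{(\bar j,a)\in P^\circ\}$, $\mathcal L(i,j)=\{(a,j)\in P^\circ:a>i\}$. $\operatorname{Limb}^\circ(A)=\bigcup_{(i,j)\in\operatorname{main}(A)}\mathcal A(i,j)\cup\mathcal L(i,j)$; $\operatorname{Limb}(A)=\operatorname{Limb}^\circ(A)$ in types $\mathfrak B_n,\mathfrak D_n$ and $\operatorname{Limb}(A)=\operatorname{Limb}^\circ(A)\cup\{(\bar j,j)\in\Gamma:\exists i,\ (i,j)\in\operatorname{r.main}(A)\cap P^\circ\}$ in type $\mathfrak C_n$. $[A]$ is main separated if $\operatorname{Limb}(A)\cap\operatorname{main}(A)=\emptyset$ (this implies staircase). $I(A)=\{(i,j):1\le i<j\le N,\ \exists\,(i,a),(j,b)\in\operatorname{main}(A)\text{ with }a<b\}\subseteq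 P$, and $U_{I(A)}$ is the subgroup of $U$ generated by all $X_{ij}$, $(i,j)\in I(A)$. *)

theory Defs
  imports
    "Jordan_Normal_Form.Matrix"
    "HOL-Algebra.Generated_Groups"
    "HOL-Computational_Algebra.Primes"
    "HOL-Library.Cardinality"
    Complex_Main
begin

section \<open>Positions\<close>

datatype lie_type = TypeB | TypeC | TypeD

definition msize :: "lie_type \<Rightarrow> nat \<Rightarrow> nat" where
  "msize T n = (if T = TypeB then 2 * n + 1 else 2 * n)"

definition ntilde :: "lie_type \<Rightarrow> nat \<Rightarrow> nat" where
  "ntilde T n = (if T = TypeB then n + 1 else n)"

text \<open>The mirror map \<open>i \<mapsto> N + 1 - i\<close>; it is only meaningful for \<open>1 \<le> i \<le> N\<close>.\<close>

definition bar :: "lie_type \<Rightarrow> nat \<Rightarrow> nat \<Rightarrow> nat" where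
  "bar T n i = msize T n + 1 - i"

definition Pcirc :: "lie_type \<Rightarrow> nat \<Rightarrow> (nat \<times> nat) set" where
  "Pcirc T n = {(i, j). 1 \<le> i \<and> i < j \<and> j < bar T n i}"

definition Gam :: "lie_type \<Rightarrow> nat \<Rightarrow> (nat \<times> nat) set" where
  "Gam T n = {(i, bar T n i) | i. 1 \<le> i \<and> i < bar T n i}"

definition Pos :: "lie_type \<Rightarrow> nat \<Rightarrow> (nat \<times> nat) set" where
  "Pos T n = (if T = TypeC then Pcirc T n \<union> Gam T n else Pcirc T n)"

section \<open>Matrices\<close>

text \<open>Positions are numbered from 1, whereas the entries of the matrix type are numbered from 0.
  All conversions happen in \<open>ent\<close>, \<open>proj\<close> and \<open>munit\<close>.\<close>

definition ent :: "'a mat \<Rightarrow> nat \<Rightarrow> nat \<Rightarrow> 'a" where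
  "ent A i j = A $$ (i - 1, j - 1)"

definition supp :: "lie_type \<Rightarrow> nat \<Rightarrow> 'a::zero mat \<Rightarrow> (nat \<times> nat) set" where
  "supp T n A = {(i, j). i \<in> {1..msize T n} \<and> j \<in> {1..msize T n} \<and> ent A i j \<noteq> 0}"

definition VV :: "lie_type \<Rightarrow> nat \<Rightarrow> 'a::zero mat set" where
  "VV T n = {A \<in> carrier_mat (msize T n) (msize T n). supp T n A \<subseteq> Pos T n}"

definition proj :: "lie_type \<Rightarrow> nat \<Rightarrow> 'a::zero mat \<Rightarrow> 'a mat" where
  "proj T n M = mat (msize T n) (msize T n)
     (\<lambda>(r, c). if (r + 1, c + 1) \<in> Pos T n then M $$ (r, c) else 0)"

definition munit :: "nat \<Rightarrow> nat \<Rightarrow> nat \<Rightarrow> 'a::zero_neq_one mat" where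
  "munit N i j = mat N N (\<lambda>(r, c). if r + 1 = i \<and> c + 1 = j then 1 else 0)"

definition kappa :: "'a::semiring_0 mat \<Rightarrow> 'a mat \<Rightarrow> 'a" where
  "kappa A B = (let M = transpose_mat A * B in \<Sum>i<dim_row M. M $$ (i, i))"

section \<open>The group U\<close>

definition Utilde :: "nat \<Rightarrow> 'a::field mat monoid" where
  "Utilde N =
     \<lparr> carrier = {A \<in> carrier_mat N N. upper_triangular A \<and> (\<forall>i<N. A $$ (i, i) = 1)},
       monoid.mult = (*), one = 1\<^sub>m N \<rparr>"

definition root_elt :: "lie_type \<Rightarrow> nat \<Rightarrow> nat \<Rightarrow> nat \<Rightarrow> 'a::field \<Rightarrow> 'a mat" where
  "root_elt T n i j \<alpha> = (let N = msize T n; b = bar T n in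
     case T of
       TypeD \<Rightarrow> 1\<^sub>m N + \<alpha> \<cdot>\<^sub>m munit N i j - \<alpha> \<cdot>\<^sub>m munit N (b j) (b i)
     | TypeB \<Rightarrow>
         (if j \<noteq> n + 1
          then 1\<^sub>m N + \<alpha> \<cdot>\<^sub>m munit N i j - \<alpha> \<cdot>\<^sub>m munit N (b j) (b i)
          else 1\<^sub>m N + \<alpha> \<cdot>\<^sub>m munit N i (n + 1) - \<alpha> \<cdot>\<^sub>m munit N (n + 1) (b i)
                 - ((1 / 2) * \<alpha>\<^sup>2) \<cdot>\<^sub>m munit N i (b i))
     | TypeC \<Rightarrow>
         (if j \<le> n
          then 1\<^sub>m N + \<alpha> \<cdot>\<^sub>m munit N i j - \<alpha> \<cdot>\<^sub>m munit N (b j) (b i)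
          else if j < b i
          then 1\<^sub>m N + \<alpha> \<cdot>\<^sub>m munit N i j + \<alpha> \<cdot>\<^sub>m munit N (b j) (b i)
          else 1\<^sub>m N + \<alpha> \<cdot>\<^sub>m munit N i (b i)))"

definition root_subgroup :: "lie_type \<Rightarrow> nat \<Rightarrow> nat \<times> nat \<Rightarrow> 'a::field mat set" where
  "root_subgroup T n = (\<lambda>(i, j). range (root_elt T n i j))"

definition UU :: "lie_type \<Rightarrow> nat \<Rightarrow> 'a::field mat monoid" where
  "UU T n = (Utilde (msize T n))
     \<lparr> carrier := generate (Utilde (msize T n)) (\<Union>r\<in>Pos T n. root_subgroup T n r) \<rparr>"

text \<open>The inverse transpose of an element of U.\<close>

definition inv_tr :: "lie_type \<Rightarrow> nat \<Rightarrow> 'a::field mat \<Rightarrow> 'a mat" where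
  "inv_tr T n g = transpose_mat (inv\<^bsub>UU T n\<^esub> g)"

section \<open>Characters and actions\<close>

definition nontrivial_character :: "('a::field \<Rightarrow> complex) \<Rightarrow> bool" where
  "nontrivial_character \<theta> \<longleftrightarrow>
     (\<forall>x. \<theta> x \<noteq> 0) \<and> (\<forall>x y. \<theta> (x + y) = \<theta> x * \<theta> y) \<and> (\<exists>x. \<theta> x \<noteq> 1)"

definition chr :: "('a::field \<Rightarrow> complex) \<Rightarrow> lie_type \<Rightarrow> nat \<Rightarrow> 'a mat \<Rightarrow> 'a mat \<Rightarrow> complex" where
  "chr \<theta> T n A = (\<lambda>B\<in>VV T n. \<theta> (kappa (- A) B))"

text \<open>For nontrivial \<open>\<theta>\<close> the map \<open>A \<mapsto> [A]\<close> is injective on V, so an element of the dual of V has a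
  unique matrix representing it; the two actions are defined through this matrix.\<close>

definition rep :: "('a::field \<Rightarrow> complex) \<Rightarrow> lie_type \<Rightarrow> nat \<Rightarrow> ('a mat \<Rightarrow> complex) \<Rightarrow> 'a mat" where
  "rep \<theta> T n = the_inv_into (VV T n) (chr \<theta> T n)"

definition ract ::
  "('a::field \<Rightarrow> complex) \<Rightarrow> lie_type \<Rightarrow> nat \<Rightarrow> ('a mat \<Rightarrow> complex) \<Rightarrow> 'a mat \<Rightarrow> ('a mat \<Rightarrow> complex)" where
  "ract \<theta> T n \<chi> g = chr \<theta> T n (proj T n (rep \<theta> T n \<chi> * inv_tr T n g))"

definition lact ::
  "('a::field \<Rightarrow> complex) \<Rightarrow> lie_type \<Rightarrow> nat \<Rightarrow> 'a mat \<Rightarrow> ('a mat \<Rightarrow> complex) \<Rightarrow> ('a mat \<Rightarrow> complex)" where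
  "lact \<theta> T n g \<chi> = chr \<theta> T n (proj T n (inv_tr T n g * rep \<theta> T n \<chi>))"

definition Stab ::
  "('a::field \<Rightarrow> complex) \<Rightarrow> lie_type \<Rightarrow> nat \<Rightarrow> ('a mat \<Rightarrow> complex) \<Rightarrow> 'a mat set" where
  "Stab \<theta> T n \<chi> = {u \<in> carrier (UU T n). ract \<theta> T n \<chi> u = \<chi>}"

definition Psi :: "('a::field \<Rightarrow> complex) \<Rightarrow> lie_type \<Rightarrow> nat \<Rightarrow> 'a mat \<Rightarrow> 'a mat \<Rightarrow> complex" where
  "Psi \<theta> T n A =
     (\<lambda>u\<in>Stab \<theta> T n (chr \<theta> T n A). \<theta> (kappa (- A) (proj T n (inv\<^bsub>UU T n\<^esub> u))))"

section \<open>Main, minor and supplementary conditions\<close>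

definition main :: "lie_type \<Rightarrow> nat \<Rightarrow> 'a::zero mat \<Rightarrow> (nat \<times> nat) set" where
  "main T n A = {(i, j) \<in> Pos T n. ent A i j \<noteq> 0 \<and> (\<forall>k\<in>{j<..msize T n}. ent A i k = 0)}"

definition l_main :: "lie_type \<Rightarrow> nat \<Rightarrow> 'a::zero mat \<Rightarrow> (nat \<times> nat) set" where
  "l_main T n A = {(i, j) \<in> main T n A. j \<le> ntilde T n}"

definition r_main :: "lie_type \<Rightarrow> nat \<Rightarrow> 'a::zero mat \<Rightarrow> (nat \<times> nat) set" where
  "r_main T n A = {(i, j) \<in> main T n A. j > ntilde T n}"

definition staircase :: "lie_type \<Rightarrow> nat \<Rightarrow> 'a::zero mat \<Rightarrow> bool" where
  "staircase T n A \<longleftrightarrow> inj_on snd (main T n A)"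

text \<open>In type C, a right main condition \<open>(i, bar i)\<close> yields the diagonal position \<open>(i, i)\<close>,
  which lies outside \<open>Pos\<close>.\<close>

definition minor :: "lie_type \<Rightarrow> nat \<Rightarrow> 'a::zero mat \<Rightarrow> (nat \<times> nat) set" where
  "minor T n A = {(i, bar T n j) | i j. (i, j) \<in> r_main T n A}"

definition suppl :: "lie_type \<Rightarrow> nat \<Rightarrow> 'a::zero mat \<Rightarrow> (nat \<times> nat) set" where
  "suppl T n A = {(i, j) \<in> Pos T n. j \<le> ntilde T n
     \<and> (\<exists>k>j. (i, k) \<in> minor T n A \<union> l_main T n A)
     \<and> (\<exists>r. (r, j) \<in> minor T n A)
     \<and> (i, j) \<notin> minor T n A \<union> main T n A}"

definition core :: "lie_type \<Rightarrow> nat \<Rightarrow> 'a::zero mat \<Rightarrow> (nat \<times> nat) set" where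
  "core T n A =
     (if T = TypeC then main T n A \<union> suppl T n A
      else main T n A \<union> minor T n A \<union> suppl T n A)"

definition core_character :: "lie_type \<Rightarrow> nat \<Rightarrow> 'a::zero mat \<Rightarrow> bool" where
  "core_character T n A \<longleftrightarrow>
     staircase T n A \<and> main T n A \<subseteq> supp T n A \<and> supp T n A \<subseteq> core T n A"

section \<open>Arms, legs and limbs\<close>

definition arm :: "lie_type \<Rightarrow> nat \<Rightarrow> nat \<Rightarrow> nat \<Rightarrow> (nat \<times> nat) set" where
  "arm T n i j = {(bar T n j, a) | a. (bar T n j, a) \<in> Pcirc T n}"

definition leg :: "lie_type \<Rightarrow> nat \<Rightarrow> nat \<Rightarrow> nat \<Rightarrow> (nat \<times> nat) set" where
  "leg T n i j = {(a, j) | a. (a, j) \<in> Pcirc T n \<and> a > i}"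

definition limb_circ :: "lie_type \<Rightarrow> nat \<Rightarrow> 'a::zero mat \<Rightarrow> (nat \<times> nat) set" where
  "limb_circ T n A = (\<Union>(i, j)\<in>main T n A. arm T n i j \<union> leg T n i j)"

definition limb :: "lie_type \<Rightarrow> nat \<Rightarrow> 'a::zero mat \<Rightarrow> (nat \<times> nat) set" where
  "limb T n A =
     (if T = TypeC
      then limb_circ T n A \<union>
        {(bar T n j, j) | j. (bar T n j, j) \<in> Gam T n \<and> (\<exists>i. (i, j) \<in> r_main T n A \<inter> Pcirc T n)}
      else limb_circ T n A)"

definition main_separated :: "lie_type \<Rightarrow> nat \<Rightarrow> 'a::zero mat \<Rightarrow> bool" where
  "main_separated T n A \<longleftrightarrow> limb T n A \<inter> main T n A = {}"

section \<open>The subgroup attached to A\<close>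

definition Iset :: "lie_type \<Rightarrow> nat \<Rightarrow> 'a::zero mat \<Rightarrow> (nat \<times> nat) set" where
  "Iset T n A = {(i, j). 1 \<le> i \<and> i < j \<and> j \<le> msize T n
     \<and> (\<exists>a b. (i, a) \<in> main T n A \<and> (j, b) \<in> main T n A \<and> a < b)}"

definition U_I :: "lie_type \<Rightarrow> nat \<Rightarrow> 'a::field mat \<Rightarrow> 'a mat set" where
  "U_I T n A = generate (UU T n) (\<Union>r\<in>Iset T n A. root_subgroup T n r)"

end

theory Submission
  imports Defs "Jordan_Normal_Form.Determinant"
begin

text \<open>
  Throughout, rows and columns are numbered \<open>1, \<dots>, N\<close>, the mirror image of \<open>i\<close> is \<open>bar i = N + 1 - i\<close>,
  and \<open>s\<^sub>i\<close> is a sign, which is \<open>-1\<close> only for \<open>i > n\<close> in type C. The group \<open>U\<close> consists of the upper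
  unitriangular isometries of the form whose Gram matrix has the entries \<open>s\<^sub>i\<close> at the positions
  \<open>(i, bar i)\<close>. Its Lie algebra consists of the strictly upper triangular \<open>z\<close> with
  \<open>z(bar j, bar i) = - s\<^sub>i s\<^sub>j z(i, j)\<close>.

  The first idea is to make the hypothesis on the two linear characters linear. For \<open>z\<close> in the Lie
  algebra the Cayley transform \<open>w = (1 - z)\<inverse>(1 + z)\<close> is a unitriangular isometry, hence an element of
  \<open>U\<close> (\<open>cayley\<close>, \<open>isometric_in_UU\<close>). If row \<open>i\<close> of \<open>A\<close> is orthogonal to row \<open>j\<close> of \<open>z\<close> whenever \<open>i < j\<close>,
  then \<open>w\<inverse>\<close> stabilises \<open>[A]\<close>, and the value of \<open>\<Psi>\<^sub>A\<close> at \<open>w\<inverse>\<close> is \<open>\<theta>(- 2 \<Sum> A(i, k) z(i, k))\<close>. All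
  multiples of \<open>z\<close> have the same property, so if \<open>\<Psi>\<^sub>A\<close> and \<open>\<Psi>\<^sub>B\<close> agree on the common stabiliser, the
  linear form \<open>z \<mapsto> \<Sum> (A - B)(i, k) z(i, k)\<close> vanishes wherever all the forms
  \<open>z \<mapsto> \<Sum> A(i, k) z(j, k)\<close> and \<open>z \<mapsto> \<Sum> B(i, k) z(j, k)\<close> with \<open>i < j\<close> do (\<open>pairing_eq\<close>). By duality it
  is a linear combination of these forms. In terms of matrices: there are lower unitriangular
  matrices \<open>L\<close>, \<open>R\<close> such that \<open>D = L A - R B\<close> is orthogonal to the Lie algebra, which means
  \<open>D(i, j) = s\<^sub>i s\<^sub>j D(bar j, bar i)\<close> for \<open>i < j\<close> (\<open>skew_difference\<close>).

  The second idea is that this symmetry forces \<open>L A\<close> and \<open>R B\<close> to agree above the diagonal in every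
  row that matters (\<open>row_equivalence\<close>). A core character has no entries in the right half of the
  matrix except its main conditions. Call \<open>c\<close> marked if column \<open>bar c\<close> contains a right main condition
  of \<open>A\<close>. Going through the columns \<open>bar c\<close> from right to left, one sees that \<open>A\<close> and \<open>B\<close> have the same
  main condition in this column, and that the column of \<open>B\<close> is zero if \<open>c\<close> is not marked: for an
  unmarked \<open>i\<close> the columns \<open>bar i\<close> of \<open>A\<close> and \<open>B\<close> are zero, so column \<open>bar i\<close> of \<open>D\<close> is zero, and by
  symmetry row \<open>i\<close> of \<open>D\<close> is zero to the right of the diagonal; for a marked \<open>i\<close>, main separation says
  that row \<open>i\<close> of \<open>A\<close> and of \<open>B\<close> is zero.

  Inverting \<open>L\<close> therefore expresses each row of \<open>A\<close> as the corresponding row of \<open>B\<close> plus a combination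
  of earlier rows of \<open>B\<close>. Since the rows of \<open>A\<close> end in different columns, and so do those of \<open>B\<close>, ends
  of rows cannot cancel. Hence \<open>A\<close> and \<open>B\<close> have the same main conditions and only coefficients at
  positions of \<open>I(A)\<close> contribute (\<open>unitriangular_transfer\<close>). Finally, these row operations are carried
  out by root elements of \<open>I(A)\<close>, from the bottom row to the top row (\<open>row_reachable_combination\<close>).
\<close>


section \<open>Duality\<close>

text \<open>
  Passing to the kernel of one of the forms removes this form, which is why \<open>S\<close> is an arbitrary
  subspace in the induction. On the whole of \<open>S\<close>, the difference between \<open>g\<close> and the combination found
  on the kernel is then a multiple of the removed form.
\<close>

lemma combination_if_vanishes_on_common_kernel:
  fixes f :: "'i \<Rightarrow> ('p \<Rightarrow> 'a::field) \<Rightarrow> 'a" and g :: "('p \<Rightarrow> 'a) \<Rightarrow> 'a"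
  assumes "finite I"
    and "\<And>v w c. v \<in> S \<Longrightarrow> w \<in> S \<Longrightarrow> (\<lambda>p. v p + c * w p) \<in> S"
    and "\<And>i v w c. i \<in> I \<Longrightarrow> f i (\<lambda>p. v p + c * w p) = f i v + c * f i w"
    and "\<And>v w c. g (\<lambda>p. v p + c * w p) = g v + c * g w"
    and "\<And>v. v \<in> S \<Longrightarrow> (\<And>i. i \<in> I \<Longrightarrow> f i v = 0) \<Longrightarrow> g v = 0"
  shows "\<exists>c. \<forall>v\<in>S. g v = (\<Sum>i\<in>I. c i * f i v)"
  using assms
proof (induction I arbitrary: S rule: finite_induct)
  case empty
  then show ?case by simp
next
  case (insert i I)
  let ?S' = "{v \<in> S. f i v = 0}"
  have "\<exists>c. \<forall>v\<in>?S'. g v = (\<Sum>j\<in>I. c j * f j v)"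
  proof (rule insert.IH)
    show "(\<lambda>p. v p + c * w p) \<in> ?S'" if "v \<in> ?S'" "w \<in> ?S'" for v w c
      using that insert.prems(1,2) by simp
    show "f j (\<lambda>p. v p + c * w p) = f j v + c * f j w" if "j \<in> I" for j v w c
      using that insert.prems(2) by simp
    show "g (\<lambda>p. v p + c * w p) = g v + c * g w" for v w c
      by (rule insert.prems(3))
    show "g v = 0" if "v \<in> ?S'" "\<And>j. j \<in> I \<Longrightarrow> f j v = 0" for v
      using that insert.prems(4)[of v] by auto
  qed
  then obtain c where c: "\<And>v. v \<in> S \<Longrightarrow> f i v = 0 \<Longrightarrow> g v = (\<Sum>j\<in>I. c j * f j v)"
    by blast
  show ?case
  proof (cases "\<exists>v\<in>S. f i v \<noteq> 0")
    case False
    then have "g v = (\<Sum>j\<in>insert i I. c j * f j v)" if "v \<in> S" for v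
      using that c insert.hyps by simp
    then show ?thesis by blast
  next
    case True
    then obtain v0 where v0: "v0 \<in> S" "f i v0 \<noteq> 0" by blast
    \<comment> \<open>chosen so that both sides agree at \<open>v0\<close>\<close>
    define d where "d = (g v0 - (\<Sum>j\<in>I. c j * f j v0)) / f i v0"
    have "g v = (\<Sum>j\<in>insert i I. (c(i := d)) j * f j v)" if v: "v \<in> S" for v
    proof -
      define t where "t = - (f i v / f i v0)"
      let ?w = "\<lambda>p. v p + t * v0 p"
      have "f i ?w = 0"
        using insert.prems(2)[of i v t v0] v0 by (simp add: t_def)
      then have "g ?w = (\<Sum>j\<in>I. c j * f j ?w)"
        using c insert.prems(1) v v0 by blast
      also have "\<dots> = (\<Sum>j\<in>I. c j * f j v) + t * (\<Sum>j\<in>I. c j * f j v0)"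
        using insert.prems(2) by (simp add: sum.distrib sum_distrib_left algebra_simps)
      finally have "g v = (\<Sum>j\<in>I. c j * f j v) - t * (g v0 - (\<Sum>j\<in>I. c j * f j v0))"
        by (simp add: insert.prems(3) algebra_simps)
      also have "\<dots> = (\<Sum>j\<in>I. c j * f j v) + d * f i v"
        using v0 by (simp add: t_def d_def)
      also have "(\<Sum>j\<in>I. c j * f j v) = (\<Sum>j\<in>I. (c(i := d)) j * f j v)"
        using insert.hyps by (intro sum.cong) auto
      finally show ?thesis
        using insert.hyps by simp
    qed
    then show ?thesis by blast
  qed
qed

section \<open>Matrices whose rows end in different columns\<close>

text \<open>
  For the matrix of an element of V these positions are its main conditions.
\<close>

definition last_nonzero :: "(nat \<Rightarrow> nat \<Rightarrow> 'a::zero) \<Rightarrow> nat \<Rightarrow> nat \<Rightarrow> bool" where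
  "last_nonzero a i j \<longleftrightarrow> a i j \<noteq> 0 \<and> (\<forall>k>j. a i k = 0)"

lemma last_nonzero_unique: "last_nonzero a i j \<Longrightarrow> last_nonzero a i k \<Longrightarrow> j = k"
  by (rule linorder_cases[of j k]) (auto simp: last_nonzero_def)

lemma last_nonzero_exists:
  assumes "a i j \<noteq> 0" and "\<And>j. a i j \<noteq> 0 \<Longrightarrow> j \<le> N"
  shows "\<exists>k\<ge>j. last_nonzero a i k"
proof -
  define K where "K = {k. a i k \<noteq> 0}"
  have K: "finite K" "j \<in> K"
    using assms by (auto simp: K_def intro!: finite_subset[of _ "{..N}"])
  then have "Max K \<in> K" by (intro Max_in) auto
  moreover have "k \<le> Max K" if "k \<in> K" for k
    using K that by simp
  ultimately have "last_nonzero a i (Max K)"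
    unfolding last_nonzero_def K_def by (auto simp flip: not_le)
  moreover have "j \<le> Max K" using K by simp
  ultimately show ?thesis by blast
qed

text \<open>
  The rows of \<open>b\<close> that enter with a nonzero coefficient end in different columns, so the rightmost of
  these ends survives in the sum and is the end of row \<open>i\<close> of \<open>a\<close>. It cannot come from a row above
  \<open>i\<close>, because row ends are already known to agree there and \<open>a\<close> has only one row end in each column.
  So it comes from row \<open>i\<close> itself, and every other row involved ends further left.
\<close>

lemma last_nonzero_transfer:
  fixes a b :: "nat \<Rightarrow> nat \<Rightarrow> 'a::field"
  assumes bound_a: "\<And>i j. a i j \<noteq> 0 \<Longrightarrow> i < j \<and> j \<le> N"
    and bound_b: "\<And>i j. b i j \<noteq> 0 \<Longrightarrow> i < j \<and> j \<le> N"
    and inj_a: "\<And>i i' j. last_nonzero a i j \<Longrightarrow> last_nonzero a i' j \<Longrightarrow> i = i'"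
    and inj_b: "\<And>i i' j. last_nonzero b i j \<Longrightarrow> last_nonzero b i' j \<Longrightarrow> i = i'"
    and comb: "\<And>j. i < j \<Longrightarrow> a i j = b i j + (\<Sum>k<i. c k * b k j)"
    and above: "\<And>k j. k < i \<Longrightarrow> last_nonzero a k j \<longleftrightarrow> last_nonzero b k j"
  shows "(\<forall>j. last_nonzero a i j \<longleftrightarrow> last_nonzero b i j) \<and>
    (\<exists>c'. (\<forall>k. c' k \<noteq> 0 \<longrightarrow> k < i \<and> (\<exists>m m'. last_nonzero a k m \<and> last_nonzero a i m' \<and> m < m')) \<and>
       (\<forall>j>i. a i j = b i j + (\<Sum>k<i. c' k * b k j)))"
proof -
  \<comment> \<open>Rows that end at or before column \<open>i\<close> do not contribute to the right of column \<open>i\<close>.\<close>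
  define c' where "c' k = (if k < i \<and> (\<exists>m>i. last_nonzero b k m) then c k else 0)" for k
  have exb: "\<exists>m\<ge>j. last_nonzero b k m" if "b k j \<noteq> 0" for k j
    using that bound_b by (intro last_nonzero_exists[where N = N]) auto
  have comb': "a i j = b i j + (\<Sum>k<i. c' k * b k j)" if "i < j" for j
  proof -
    have "c' k * b k j = c k * b k j" if "k < i" for k
    proof (cases "b k j = 0")
      case False
      then have "\<exists>m>i. last_nonzero b k m" using exb[of k j] \<open>i < j\<close> by (meson order_less_le_trans)
      then show ?thesis using that by (simp add: c'_def)
    qed simp
    then have "(\<Sum>k<i. c' k * b k j) = (\<Sum>k<i. c k * b k j)" by (intro sum.cong) auto
    then show ?thesis using comb[OF that] by simp
  qed
  define K where "K = {k. (k < i \<and> c' k \<noteq> 0) \<or> (k = i \<and> (\<exists>j. b i j \<noteq> 0))}"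
  have finK: "finite K" by (rule finite_subset[of _ "{..i}"]) (auto simp: K_def)
  have mainK: "\<exists>m>i. last_nonzero b k m" if "k \<in> K" for k
  proof (cases "k = i")
    case True
    then have "\<exists>j. b i j \<noteq> 0" using that unfolding K_def by simp
    then obtain j where "b i j \<noteq> 0" by blast
    then show ?thesis using exb[of i j] bound_b[of i j] True by (meson order_less_le_trans)
  next
    case False
    then show ?thesis using that by (auto simp: K_def c'_def split: if_splits)
  qed
  show ?thesis
  proof (cases "K = {}")
    case True
    have bz: "b i j = 0" for j using True by (auto simp: K_def)
    have cz: "c' k = 0" for k
    proof (rule ccontr)
      assume "c' k \<noteq> 0"
      moreover from this have "k < i" by (simp add: c'_def split: if_splits)
      ultimately show False using True unfolding K_def by blast
    qed
    have az: "a i j = 0" for j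
      using comb'[of j] bound_a[of i j] by (cases "i < j") (auto simp: bz cz)
    have "\<forall>j. last_nonzero a i j \<longleftrightarrow> last_nonzero b i j" using az bz by (simp add: last_nonzero_def)
    moreover have "\<forall>j>i. a i j = b i j + (\<Sum>k<i. c' k * b k j)" using comb' by simp
    ultimately show ?thesis using cz by blast
  next
    case False
    define \<mu> where "\<mu> k = (THE m. last_nonzero b k m)" for k
    have \<mu>: "last_nonzero b k (\<mu> k)" "\<mu> k > i" if k: "k \<in> K" for k
    proof -
      obtain m where m: "m > i" "last_nonzero b k m" using mainK[OF k] by blast
      have "\<mu> k = m" unfolding \<mu>_def using m last_nonzero_unique by (intro the_equality) auto
      then show "last_nonzero b k (\<mu> k)" "\<mu> k > i" using m by auto
    qed
    obtain q where q: "q \<in> K" "\<And>k. k \<in> K \<Longrightarrow> \<mu> k \<le> \<mu> q"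
    proof -
      have "Max (\<mu> ` K) \<in> \<mu> ` K" using False finK by (intro Max_in) auto
      then obtain q where "q \<in> K" "\<mu> q = Max (\<mu> ` K)" by auto
      then show ?thesis using that[of q] finK by simp
    qed
    have lt: "\<mu> k < \<mu> q" if "k \<in> K" "k \<noteq> q" for k
      using q(2)[OF that(1)] \<mu>[OF that(1)] \<mu>[OF q(1)] that(2) inj_b by (metis le_neq_implies_less)
    define d where "d k = (if k = i then 1 else c' k)" for k
    have expand: "a i j = (\<Sum>k\<in>K. d k * b k j)" if "i < j" for j
    proof -
      have "(\<Sum>k\<in>K. d k * b k j) = (\<Sum>k\<le>i. d k * b k j)"
      proof (rule sum.mono_neutral_left)
        show "K \<subseteq> {..i}" by (auto simp: K_def)
        show "\<forall>k\<in>{..i} - K. d k * b k j = 0" by (auto simp: K_def d_def)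
      qed simp
      also have "\<dots> = (\<Sum>k<i. d k * b k j) + d i * b i j"
        by (simp add: lessThan_Suc_atMost[symmetric])
      also have "(\<Sum>k<i. d k * b k j) = (\<Sum>k<i. c' k * b k j)"
        by (intro sum.cong) (auto simp: d_def)
      finally show ?thesis using comb'[OF that] by (simp add: d_def)
    qed
    have "a i (\<mu> q) = d q * b q (\<mu> q)"
    proof -
      have "(\<Sum>k\<in>K - {q}. d k * b k (\<mu> q)) = 0"
        using lt \<mu>(1) by (intro sum.neutral) (auto simp: last_nonzero_def)
      then show ?thesis using expand[of "\<mu> q"] \<mu>(2)[OF q(1)] finK q(1)
        by (simp add: sum.remove)
    qed
    moreover have "d q \<noteq> 0" using q(1) by (auto simp: K_def d_def)
    moreover have "a i j = 0" if "j > \<mu> q" for j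
    proof -
      have "b k j = 0" if "k \<in> K" for k
        using q(2)[OF that] \<mu>(1)[OF that] \<open>j > \<mu> q\<close> by (auto simp: last_nonzero_def)
      then show ?thesis using expand[of j] that \<mu>(2)[OF q(1)] by simp
    qed
    ultimately have maini: "last_nonzero a i (\<mu> q)"
      using \<mu>(1)[OF q(1)] by (simp add: last_nonzero_def)
    have "q = i"
    proof (rule ccontr)
      assume "q \<noteq> i"
      then have "q < i" using q(1) by (auto simp: K_def)
      then show False using above \<mu>(1)[OF q(1)] maini inj_a \<open>q \<noteq> i\<close> by blast
    qed
    have "\<forall>j. last_nonzero a i j \<longleftrightarrow> last_nonzero b i j"
      using maini \<mu>(1)[OF q(1)] \<open>q = i\<close> last_nonzero_unique by metis
    moreover have "k < i \<and> (\<exists>m m'. last_nonzero a k m \<and> last_nonzero a i m' \<and> m < m')" if "c' k \<noteq> 0" for k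
    proof -
      have k: "k < i" "k \<in> K" using that by (auto simp: K_def c'_def split: if_splits)
      then show ?thesis using lt[of k] \<mu>(1)[of k] above[of k] maini \<open>q = i\<close> by blast
    qed
    ultimately show ?thesis using comb' by blast
  qed
qed

text \<open>
  Solving for \<open>a\<close> amounts to inverting the unitriangular matrix on the left. Only columns to the
  right of the diagonal are compared, but row \<open>i\<close> uses the rows \<open>k < i\<close> only in columns \<open>j > i > k\<close>, so
  the truncation does no harm.
\<close>

lemma unitriangular_transfer:
  fixes a b :: "nat \<Rightarrow> nat \<Rightarrow> 'a::field"
  assumes bound_a: "\<And>i j. a i j \<noteq> 0 \<Longrightarrow> i < j \<and> j \<le> N"
    and bound_b: "\<And>i j. b i j \<noteq> 0 \<Longrightarrow> i < j \<and> j \<le> N"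
    and inj_a: "\<And>i i' j. last_nonzero a i j \<Longrightarrow> last_nonzero a i' j \<Longrightarrow> i = i'"
    and inj_b: "\<And>i i' j. last_nonzero b i j \<Longrightarrow> last_nonzero b i' j \<Longrightarrow> i = i'"
    and eq: "\<And>i j. i < j \<Longrightarrow> a i j + (\<Sum>k<i. l i k * a k j) = b i j + (\<Sum>k<i. r i k * b k j)"
  shows "\<exists>c. (\<forall>i k. c i k \<noteq> 0 \<longrightarrow> k < i \<and> (\<exists>m m'. last_nonzero a k m \<and> last_nonzero a i m' \<and> m < m')) \<and>
       (\<forall>i j. i < j \<longrightarrow> a i j = b i j + (\<Sum>k<i. c i k * b k j))"
proof -
  have ex: "\<exists>c. \<forall>j>i. a i j = b i j + (\<Sum>k<i. c k * b k j)" for i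
  proof (induction i rule: less_induct)
    case (less i)
    then obtain c where c: "\<And>k j. k < i \<Longrightarrow> k < j \<Longrightarrow> a k j = b k j + (\<Sum>k'<k. c k k' * b k' j)"
      by metis
    define e where "e k = r i k - l i k - (\<Sum>k'\<in>{k<..<i}. l i k' * c k' k)" for k
    have "a i j = b i j + (\<Sum>k<i. e k * b k j)" if "j > i" for j
    proof -
      have "(\<Sum>k<i. l i k * a k j) = (\<Sum>k<i. l i k * b k j + (\<Sum>k'<k. l i k * c k k' * b k' j))"
        using c that by (intro sum.cong) (auto simp: distrib_left sum_distrib_left mult.assoc)
      also have "\<dots> = (\<Sum>k<i. l i k * b k j) + (\<Sum>k<i. \<Sum>k'<k. l i k * c k k' * b k' j)"
        by (simp add: sum.distrib)
      also have "(\<Sum>k<i. \<Sum>k'<k. l i k * c k k' * b k' j)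
          = (\<Sum>k'<i. \<Sum>k\<in>{k'<..<i}. l i k * c k k' * b k' j)"
        unfolding sum.Sigma[OF finite_lessThan ballI[OF finite_lessThan]] 
          sum.Sigma[OF finite_lessThan ballI[OF finite_greaterThanLessThan]]
        by (rule sum.reindex_bij_witness[of _ "\<lambda>(x,y). (y,x)" "\<lambda>(x,y). (y,x)"]) auto
      also have "\<dots> = (\<Sum>k<i. (\<Sum>k'\<in>{k<..<i}. l i k' * c k' k) * b k j)"
        by (simp add: sum_distrib_right)
      finally show ?thesis
        using eq[OF that] by (simp add: e_def left_diff_distrib sum_subtractf sum.distrib algebra_simps)
    qed
    then show ?case by blast
  qed
  let ?pattern = "\<lambda>i c. \<forall>k. c k \<noteq> 0 \<longrightarrow> k < i \<and> (\<exists>m m'. last_nonzero a k m \<and> last_nonzero a i m' \<and> m < m')"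
  have transfer: "(\<forall>j. last_nonzero a i j \<longleftrightarrow> last_nonzero b i j) \<and>
      (\<exists>c. ?pattern i c \<and> (\<forall>j>i. a i j = b i j + (\<Sum>k<i. c k * b k j)))"
    if above: "\<forall>k<i. \<forall>j. last_nonzero a k j \<longleftrightarrow> last_nonzero b k j" for i
  proof -
    obtain c where c: "\<forall>j>i. a i j = b i j + (\<Sum>k<i. c k * b k j)" using ex by blast
    show ?thesis
    proof (rule last_nonzero_transfer[where N = N and c = c])
      show "a i j = b i j + (\<Sum>k<i. c k * b k j)" if "i < j" for j using c that by blast
      show "last_nonzero a k j \<longleftrightarrow> last_nonzero b k j" if "k < i" for k j using above that by blast
    qed (fact bound_a bound_b inj_a inj_b)+
  qed
  have same: "\<forall>j. last_nonzero a i j \<longleftrightarrow> last_nonzero b i j" for i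
  proof (induction i rule: less_induct)
    case (less i)
    then show ?case using transfer by blast
  qed
  have "\<exists>c. ?pattern i c \<and> (\<forall>j>i. a i j = b i j + (\<Sum>k<i. c k * b k j))" for i
    by (rule conjunct2[OF transfer]) (simp add: same)
  then have "\<exists>c. \<forall>i. ?pattern i (c i) \<and> (\<forall>j>i. a i j = b i j + (\<Sum>k<i. c i k * b k j))"
    by (intro choice allI)
  then obtain c where c: "\<forall>i. ?pattern i (c i) \<and> (\<forall>j>i. a i j = b i j + (\<Sum>k<i. c i k * b k j))"
    by (elim exE)
  show ?thesis by (intro exI[of _ c]) (use c in simp)
qed

section \<open>Two matrices with a symmetric difference\<close>

text \<open>
  The symmetry of \<open>D\<close> couples row \<open>i\<close>, to the right of the diagonal, with column \<open>mir i\<close>. Where that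
  column is zero in \<open>a\<close> and \<open>b\<close> it is zero in \<open>D\<close>, so row \<open>i\<close> of \<open>D\<close> is zero as well, and the row
  combinations of \<open>a\<close> and \<open>b\<close> agree there. Where it is not zero it contains a row end \<open>(q, mir i)\<close>, and
  the separation hypotheses make row \<open>i\<close> zero.
\<close>

lemma row_equivalence:
  fixes a b :: "nat \<Rightarrow> nat \<Rightarrow> 'a::field" and N :: nat and mir :: "nat \<Rightarrow> nat"
  assumes mir_def: "\<And>i. mir i = N + 1 - i"
    and supp_a: "\<And>i j. a i j \<noteq> 0 \<Longrightarrow> 1 \<le> i \<and> i < j \<and> j < mir i"
    and supp_b: "\<And>i j. b i j \<noteq> 0 \<Longrightarrow> 1 \<le> i \<and> i < j \<and> j < mir i"
    and inj_a: "\<And>i i' j. last_nonzero a i j \<Longrightarrow> last_nonzero a i' j \<Longrightarrow> i = i'"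
    and inj_b: "\<And>i i' j. last_nonzero b i j \<Longrightarrow> last_nonzero b i' j \<Longrightarrow> i = i'"
    and sep_a: "\<And>i j k. last_nonzero a i j \<Longrightarrow> a (mir j) k = 0"
    and sep_b: "\<And>i j k. last_nonzero b i j \<Longrightarrow> b (mir j) k = 0"
    and core_a: "\<And>i j. a i j \<noteq> 0 \<Longrightarrow> mir j < j \<Longrightarrow> last_nonzero a i j"
    and symm: "\<And>i j. 1 \<le> i \<Longrightarrow> i < j \<Longrightarrow> j \<le> N \<Longrightarrow> D i j = s i j * D (mir j) (mir i)"
    and D: "\<And>i j. D i j = a i j - b i j + (\<Sum>k<i. l i k * a k j) - (\<Sum>k<i. r i k * b k j)"
  shows "\<exists>c. (\<forall>i k. c i k \<noteq> 0 \<longrightarrow> k < i \<and> (\<exists>m m'. last_nonzero a k m \<and> last_nonzero a i m' \<and> m < m')) \<and>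
       (\<forall>i j. i < j \<longrightarrow> a i j = b i j + (\<Sum>k<i. c i k * b k j))"
proof -
  have bound_a: "i < j \<and> j \<le> N" if "a i j \<noteq> 0" for i j
    using supp_a[OF that] by (auto simp: mir_def)
  have bound_b: "i < j \<and> j \<le> N" if "b i j \<noteq> 0" for i j
    using supp_b[OF that] by (auto simp: mir_def)
  \<comment> \<open>the marked indices: column \<open>mir c\<close> of \<open>a\<close> contains the end of a row\<close>
  define Mi where "Mi = {c. \<exists>i. last_nonzero a i (mir c)}"
  have D_zero: "D i j = 0" if "1 \<le> i" "i < j" "j \<le> N" 
    "\<And>k. a k (mir i) = 0" "\<And>k. b k (mir i) = 0" for i j
    using symm[OF that(1-3)] by (simp add: D that(4,5))
  have right: "(\<forall>i. last_nonzero a i (mir c) \<longleftrightarrow> last_nonzero b i (mir c)) \<and>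
      (c \<notin> Mi \<longrightarrow> (\<forall>i. a i (mir c) = 0 \<and> b i (mir c) = 0))" if "1 \<le> c" "c < mir c" for c
    using that
  proof (induction c rule: less_induct)
    case (less c)
    let ?y = "mir c"
    have my: "mir ?y = c" using less.prems by (auto simp: mir_def)
    have az: "a i ?y = 0" if "\<not> last_nonzero a i ?y" for i
      using core_a[of i ?y] that my less.prems by auto
    have row: "a i ?y + (\<Sum>k<i. l i k * a k ?y) = b i ?y + (\<Sum>k<i. r i k * b k ?y)"
      if i: "1 \<le> i" "i < c" "i \<notin> Mi" for i
    proof -
      have "i < mir i" "?y \<le> N" "i < ?y" using i less.prems by (auto simp: mir_def)
      moreover have "\<forall>k. a k (mir i) = 0 \<and> b k (mir i) = 0"
        using less.IH[of i] i \<open>i < mir i\<close> by blast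
      ultimately have "D i ?y = 0" using i D_zero by blast
      then show ?thesis by (simp add: D algebra_simps)
    qed
    have Mirow: "a i k = 0 \<and> b i k = 0" if i: "1 \<le> i" "i < c" "i \<in> Mi" for i k
    proof -
      have i': "i < mir i" "mir (mir i) = i" using i less.prems by (auto simp: mir_def)
      obtain q where q: "last_nonzero a q (mir i)" using i by (auto simp: Mi_def)
      then have "last_nonzero b q (mir i)" using less.IH[of i] i i' by blast
      then show ?thesis using sep_a[OF q] sep_b i' by metis
    qed
    have small: "1 \<le> i \<and> i < c" if "a i ?y \<noteq> 0 \<or> b i ?y \<noteq> 0" for i
      using supp_a[of i ?y] supp_b[of i ?y] that less.prems by (auto simp: mir_def)
    \<comment> \<open>Above the first nonzero entry of column \<open>?y\<close> of \<open>a\<close>, this column of \<open>b\<close> is zero as well.\<close>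
    have bz: "b i ?y = 0" if "\<And>k. k \<le> i \<Longrightarrow> a k ?y = 0" for i
      using that
    proof (induction i rule: less_induct)
      case (less i)
      show ?case
      proof (rule ccontr)
        assume nz: "b i ?y \<noteq> 0"
        then have "1 \<le> i" "i < c" "i \<notin> Mi" using small[of i] Mirow[of i] by auto
        from row[OF this] have "0 = b i ?y + (\<Sum>k<i. r i k * b k ?y)"
          using less.prems by simp
        then show False using nz less by simp
      qed
    qed
    show ?case
    proof (cases "c \<in> Mi")
      case False
      then have a0: "a i ?y = 0" for i using az[of i] by (auto simp: Mi_def)
      then have "b i ?y = 0" for i using bz by blast
      then show ?thesis using a0 by (simp add: last_nonzero_def)
    next
      case True
      then obtain q where q: "last_nonzero a q ?y" by (auto simp: Mi_def)
      have a0: "a i ?y = 0" if "i \<noteq> q" for i using az[of i] inj_a[OF q] that by blast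
      have aq: "a q ?y \<noteq> 0" using q by (simp add: last_nonzero_def)
      have qc: "1 \<le> q" "q < c" "q \<notin> Mi" using small[of q] Mirow[of q] aq by auto
      have "b i ?y = 0" if "i < q" for i using bz a0 that by auto
      then have bq: "b q ?y = a q ?y" using row[OF qc] a0 by simp
      \<comment> \<open>An entry further right would make row \<open>q\<close> of \<open>b\<close> end in a column treated before,
          where row \<open>q\<close> of \<open>a\<close> would end as well.\<close>
      have "b q j = 0" if "j > ?y" for j
      proof (rule ccontr)
        assume "b q j \<noteq> 0"
        then obtain m where m: "m \<ge> j" "last_nonzero b q m" 
          using last_nonzero_exists[of b q j N] bound_b by blast
        then have "m \<le> N" using bound_b by (auto simp: last_nonzero_def)
        define c' where "c' = mir m"
        have c': "1 \<le> c'" "c' < c" "c' < mir c'" "mir c' = m"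
          using \<open>m \<le> N\<close> m that less.prems by (auto simp: mir_def c'_def)
        then have "last_nonzero a q m" using less.IH[of c'] m(2) by auto
        then show False using q m(1) that last_nonzero_unique[of a q m ?y] by simp
      qed
      then have qb: "last_nonzero b q ?y" using bq aq by (simp add: last_nonzero_def)
      then show ?thesis using q True inj_a inj_b by blast
    qed
  qed
  \<comment> \<open>the rows in which the symmetry of \<open>D\<close> yields information; all other rows are zero\<close>
  define G where "G = {i. 1 \<le> i \<and> i < mir i \<and> i \<notin> Mi}"
  define l' where "l' i k = (if i \<in> G then l i k else 0)" for i k
  define r' where "r' i k = (if i \<in> G then r i k else 0)" for i k
  have zero_row: "a i j = 0 \<and> b i j = 0" if "i \<notin> G" for i j
  proof (cases "1 \<le> i \<and> i < mir i")
    case True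
    then have "i \<in> Mi" "mir (mir i) = i" using that by (auto simp: G_def mir_def)
    then obtain q where q: "last_nonzero a q (mir i)" by (auto simp: Mi_def)
    then have "last_nonzero b q (mir i)" using right True by blast
    then show ?thesis using sep_a[OF q] sep_b \<open>mir (mir i) = i\<close> by metis
  next
    case False
    then show ?thesis using supp_a[of i j] supp_b[of i j] by fastforce
  qed
  have eq: "a i j + (\<Sum>k<i. l' i k * a k j) = b i j + (\<Sum>k<i. r' i k * b k j)" if "i < j" for i j
  proof (cases "i \<in> G \<and> j \<le> N")
    case True
    then have "D i j = 0" using D_zero[of i j] right[of i] that by (auto simp: G_def)
    then show ?thesis using True by (simp add: D l'_def r'_def algebra_simps)
  next
    case False
    then have "j > N \<or> i \<notin> G" by auto
    then show ?thesis
    proof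
      assume "j > N"
      then have "a k j = 0 \<and> b k j = 0" for k using bound_a[of k j] bound_b[of k j] by force
      then show ?thesis by simp
    qed (use zero_row in \<open>simp add: l'_def r'_def\<close>)
  qed
  show ?thesis
    by (rule unitriangular_transfer[OF bound_a bound_b inj_a inj_b eq])
qed

declare One_nat_def [simp del] \<comment> \<open>indices start at \<open>1\<close>, which has to stay a numeral\<close>

section \<open>Entries of matrices\<close>

lemma ent_mult:
  fixes A B :: "'a::comm_semiring_0 mat"
  assumes "A \<in> carrier_mat N N" "B \<in> carrier_mat N N" "i \<in> {1..N}" "j \<in> {1..N}"
  shows "ent (A * B) i j = (\<Sum>k=1..N. ent A i k * ent B k j)"
  using assms by (auto simp: ent_def scalar_prod_def sum.atLeast1_atMost_eq[unfolded One_nat_def] One_nat_def atLeast0LessThan)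

lemma ent_transpose:
  assumes "A \<in> carrier_mat N N" "i \<in> {1..N}" "j \<in> {1..N}"
  shows "ent (transpose_mat A) i j = ent A j i"
  using assms by (auto simp: ent_def)

lemma ent_one:
  assumes "i \<in> {1..N}" "j \<in> {1..N}"
  shows "ent (1\<^sub>m N) i j = (if i = j then 1 else 0)"
  using assms by (auto simp: ent_def)

lemma ent_add_minus_smult:
  assumes "i \<in> {1..N}" "j \<in> {1..N}" "B \<in> carrier_mat N N"
  shows "ent (A + B) i j = ent A i j + ent B i j" 
    and "ent (A - B) i j = ent A i j - ent B i j"
    and "ent (c \<cdot>\<^sub>m B) i j = c * ent B i j"
  using assms by (auto simp: ent_def)

lemma eq_entI:
  assumes "A \<in> carrier_mat N N" "B \<in> carrier_mat N N"
    and "\<And>i j. i \<in> {1..N} \<Longrightarrow> j \<in> {1..N} \<Longrightarrow> ent A i j = ent B i j"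
  shows "A = B"
proof (rule eq_matI)
  show "A $$ (i, j) = B $$ (i, j)" if "i < dim_row B" "j < dim_col B" for i j
    using assms(3)[of "Suc i" "Suc j"] that assms(1,2) by (simp add: ent_def)
qed (use assms in auto)

section \<open>The unitriangular group\<close>

lemma Utilde_carrier_iff:
  "A \<in> carrier (Utilde N) \<longleftrightarrow> A \<in> carrier_mat N N \<and>
     (\<forall>i\<in>{1..N}. \<forall>j\<in>{1..N}. j \<le> i \<longrightarrow> ent A i j = (if i = j then 1 else 0))"
  (is "?l \<longleftrightarrow> ?r")
proof
  assume l: ?l
  show ?r
  proof (intro conjI ballI impI)
    show "A \<in> carrier_mat N N" using l by (simp add: Utilde_def)
    fix i j assume "i \<in> {1..N}" "j \<in> {1..N}" "j \<le> i"
    moreover have "A $$ (i - 1, j - 1) = 0" if "j - 1 < i - 1" "i - 1 < N"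
      using l that by (auto simp: Utilde_def)
    ultimately show "ent A i j = (if i = j then 1 else 0)"
      using l by (auto simp: Utilde_def ent_def)
  qed
next
  assume r: ?r
  have "A $$ (i, j) = 0" if "j < i" "i < N" for i j
    using r[THEN conjunct2, rule_format, of "Suc i" "Suc j"] that by (simp add: ent_def)
  moreover have "A $$ (i, i) = 1" if "i < N" for i
    using r[THEN conjunct2, rule_format, of "Suc i" "Suc i"] that by (simp add: ent_def)
  ultimately show ?l using r by (auto simp: Utilde_def)
qed

lemma Utilde_carrier_mat: "A \<in> carrier (Utilde N) \<Longrightarrow> A \<in> carrier_mat N N"
  by (simp add: Utilde_carrier_iff)

lemma Utilde_ent: 
  "A \<in> carrier (Utilde N) \<Longrightarrow> i \<in> {1..N} \<Longrightarrow> j \<in> {1..N} \<Longrightarrow> j \<le> i \<Longrightarrow> ent A i j = (if i = j then 1 else 0)"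
  by (simp add: Utilde_carrier_iff)

lemma Utilde_simps [simp]:
  "A \<otimes>\<^bsub>Utilde N\<^esub> B = A * B" "\<one>\<^bsub>Utilde N\<^esub> = 1\<^sub>m N"
  by (simp_all add: Utilde_def)

lemma Utilde_mult_closed:
  assumes A: "A \<in> carrier (Utilde N)" and B: "B \<in> carrier (Utilde N)"
  shows "A * B \<in> carrier (Utilde N)"
  unfolding Utilde_carrier_iff
proof (intro conjI ballI impI)
  note AB = Utilde_carrier_mat[OF A] Utilde_carrier_mat[OF B]
  show "A * B \<in> carrier_mat N N" using AB by simp
  fix i j assume ij: "i \<in> {1..N}" "j \<in> {1..N}" "j \<le> i"
  have "ent (A * B) i j = (\<Sum>k=1..N. ent A i k * ent B k j)"
    by (rule ent_mult[OF AB ij(1,2)])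
  also have "\<dots> = (\<Sum>k=1..N. if k = i then (if i = j then 1 else 0) else 0)"
  proof (intro sum.cong refl)
    fix k assume "k \<in> {1..N}"
    then show "ent A i k * ent B k j = (if k = i then (if i = j then 1 else 0) else 0)"
      using ij Utilde_ent[OF A ij(1), of k] Utilde_ent[OF B _ ij(2), of k] 
      by (cases "k \<le> i") auto
  qed
  also have "\<dots> = (if i = j then 1 else 0)" using ij by simp
  finally show "ent (A * B) i j = (if i = j then 1 else 0)" .
qed

lemma Utilde_one_closed: "1\<^sub>m N \<in> carrier (Utilde N)"
  by (auto simp: Utilde_carrier_iff ent_one)

text \<open>
  The inverse of a matrix of determinant 1 exists; that it is again unitriangular is read off from
  \<open>A B = 1\<close>, row by row from the bottom.
\<close>

lemma Utilde_left_inverse: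
  fixes A :: "'a::field mat"
  assumes A: "A \<in> carrier (Utilde N)"
  shows "\<exists>B\<in>carrier (Utilde N). B * A = 1\<^sub>m N"
proof -
  note Ac = Utilde_carrier_mat[OF A]
  have "upper_triangular A" using A by (simp add: Utilde_def)
  then have "det A = prod_list (diag_mat A)" using det_upper_triangular Ac by blast
  moreover have "0 \<notin> set (diag_mat A)" using A by (auto simp: Utilde_def diag_mat_def)
  ultimately have "det A \<noteq> 0" by (simp add: prod_list_zero_iff)
  then have "A \<in> Units (ring_mat TYPE('a) N ())" by (rule det_non_zero_imp_unit[OF Ac])
  then obtain B where B: "B \<in> carrier_mat N N" "B * A = 1\<^sub>m N" "A * B = 1\<^sub>m N"
    by (auto simp: Units_def ring_mat_def)
  have "\<forall>j\<in>{1..i}. ent B i j = (if i = j then 1 else 0)" if "i \<in> {1..N}" for i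
    using that
  proof (induction "N - i" arbitrary: i rule: less_induct)
    case less
    show ?case
    proof
      fix j assume j: "j \<in> {1..i}"
      then have jN: "j \<in> {1..N}" using less.prems by auto
      have "(if i = j then 1 else 0) = (\<Sum>k=1..N. ent A i k * ent B k j)"
        unfolding ent_mult[OF Ac B(1) less.prems jN, symmetric] B(3)
        by (simp add: ent_one[OF less.prems jN])
      also have "\<dots> = (\<Sum>k=1..N. if k = i then ent B i j else 0)"
      proof (intro sum.cong refl)
        fix k assume k: "k \<in> {1..N}"
        have "ent B k j = 0" if "k > i"
          using less.hyps[of k] that k j less.prems by auto
        then show "ent A i k * ent B k j = (if k = i then ent B i j else 0)"
          using Utilde_ent[OF A less.prems k] by (cases k i rule: linorder_cases) auto
      qed
      also have "\<dots> = ent B i j" using less.prems by simp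
      finally show "ent B i j = (if i = j then 1 else 0)" by simp
    qed
  qed
  then have "B \<in> carrier (Utilde N)" using B(1) by (auto simp: Utilde_carrier_iff)
  then show ?thesis using B(2) by blast
qed

lemma group_Utilde: "group (Utilde N :: 'a::field mat monoid)"
proof (rule groupI)
  fix x y z :: "'a mat"
  assume "x \<in> carrier (Utilde N)" "y \<in> carrier (Utilde N)" "z \<in> carrier (Utilde N)"
  then show "x \<otimes>\<^bsub>Utilde N\<^esub> y \<otimes>\<^bsub>Utilde N\<^esub> z = x \<otimes>\<^bsub>Utilde N\<^esub> (y \<otimes>\<^bsub>Utilde N\<^esub> z)"
    using assoc_mult_mat by (metis Utilde_carrier_mat Utilde_simps(1))
next
  show "\<one>\<^bsub>Utilde N\<^esub> \<otimes>\<^bsub>Utilde N\<^esub> x = x" if "x \<in> carrier (Utilde N)" for x :: "'a mat"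
    using Utilde_carrier_mat[OF that] by simp
qed (use Utilde_mult_closed Utilde_one_closed Utilde_left_inverse in auto)

section \<open>Mirror indices, signs and root elements\<close>

text \<open>
  The signs of the root elements: \<open>x\<^sub>i\<^sub>j(\<alpha>)\<close> has the entry \<open>- s\<^sub>i s\<^sub>j \<alpha>\<close> at the mirror image
  \<open>(bar j, bar i)\<close> of a position \<open>(i, j)\<close> off the antidiagonal, in all three types.
\<close>

definition form_sign :: "lie_type \<Rightarrow> nat \<Rightarrow> nat \<Rightarrow> 'a::field" where
  "form_sign T n i = (if T = TypeC \<and> n < i then -1 else 1)"

lemma form_sign_sq [simp]: "form_sign T n i * form_sign T n i = 1" by (simp add: form_sign_def)
lemma form_sign_nz [simp]: "form_sign T n i \<noteq> 0" by (simp add: form_sign_def)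

lemma bar_in [simp]: "i \<in> {1..msize T n} \<Longrightarrow> bar T n i \<in> {1..msize T n}"
  by (auto simp: bar_def)

lemma bar_bar [simp]: "i \<in> {1..msize T n} \<Longrightarrow> bar T n (bar T n i) = i"
  by (auto simp: bar_def)

lemma sum_bar: "(\<Sum>k=1..msize T n. f (bar T n k)) = (\<Sum>k=1..msize T n. f k)"
  by (rule sum.reindex_bij_witness[of _ "bar T n" "bar T n"]) (auto simp: bar_def)

lemma Pos_bounds:
  assumes "(i, j) \<in> Pos T n"
  shows "1 \<le> i" "i < j" "j \<le> bar T n i" "i \<le> n" "i \<in> {1..msize T n}" "j \<in> {1..msize T n}"
  using assms by (auto simp: Pos_def Pcirc_def Gam_def bar_def msize_def split: if_splits)

lemma Pos_iff: "(i, j) \<in> Pos T n \<longleftrightarrow> 1 \<le> i \<and> i < j \<and> (if T = TypeC then j \<le> bar T n i else j < bar T n i)"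
  by (auto simp: Pos_def Pcirc_def Gam_def)

lemma munit_carrier: "munit N i j \<in> carrier_mat N N" by (simp add: munit_def)

lemma ent_munit:
  "a \<in> {1..N} \<Longrightarrow> b \<in> {1..N} \<Longrightarrow> ent (munit N i j) a b = (if a = i \<and> b = j then 1 else 0)"
  by (auto simp: ent_def munit_def)

lemma root_elt_carrier: "root_elt T n i j \<alpha> \<in> carrier_mat (msize T n) (msize T n)"
  by (cases T) (auto simp: root_elt_def Let_def munit_def)

text \<open>
  With these coefficients a single formula describes all root elements, see \<open>root_elt_eq\<close> below.
  A position on the antidiagonal is its own mirror image, and the quadratic term occurs only in the
  middle column of type B.
\<close>

definition mirror_coeff :: "lie_type \<Rightarrow> nat \<Rightarrow> nat \<Rightarrow> nat \<Rightarrow> 'a::field \<Rightarrow> 'a" where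
  "mirror_coeff T n i j \<alpha> = (if j = bar T n i then 0 else form_sign T n i * form_sign T n j * \<alpha>)"

definition middle_coeff :: "lie_type \<Rightarrow> nat \<Rightarrow> nat \<Rightarrow> 'a::field \<Rightarrow> 'a" where
  "middle_coeff T n j \<alpha> = (if j = bar T n j then (1 / 2) * \<alpha>\<^sup>2 else 0)"

lemma root_elt_eq:
  assumes "(i, j) \<in> Pos T n"
  shows "root_elt T n i j \<alpha> = 1\<^sub>m (msize T n) + \<alpha> \<cdot>\<^sub>m munit (msize T n) i j
     - mirror_coeff T n i j \<alpha> \<cdot>\<^sub>m munit (msize T n) (bar T n j) (bar T n i)
     - middle_coeff T n j \<alpha> \<cdot>\<^sub>m munit (msize T n) i (bar T n i)"
proof -
  note P = Pos_bounds[OF assms(1)]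
  let ?N = "msize T n" and ?b = "bar T n"
  have minus_zero: "A - 0 \<cdot>\<^sub>m munit ?N u v = A" if "A \<in> carrier_mat ?N ?N" for A :: "'a mat" and u v
    using that by (intro eq_matI) (auto simp: munit_def)
  have plus: "A + \<beta> \<cdot>\<^sub>m munit ?N u v = A - (- \<beta>) \<cdot>\<^sub>m munit ?N u v" 
    if "A \<in> carrier_mat ?N ?N" for A :: "'a mat" and u v \<beta>
    using that by (intro eq_matI) (auto simp: munit_def)
  note mc = munit_carrier minus_zero minus_carrier_mat
  show ?thesis
  proof (cases T)
    case TypeB
    have b: "j = n + 1 \<longleftrightarrow> j = ?b j" "j \<noteq> ?b i" 
      using TypeB P assms(1) by (auto simp: bar_def msize_def Pos_def Pcirc_def)
    have s: "mirror_coeff T n i j \<alpha> = \<alpha>" using TypeB b by (simp add: form_sign_def mirror_coeff_def)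
    show ?thesis
    proof (cases "j = n + 1")
      case True
      then have "?b (n + 1) = n + 1" using b by simp
      then show ?thesis unfolding s using b True 
        by (simp add: root_elt_def Let_def middle_coeff_def) (simp add: TypeB)
    next
      case False
      then have "middle_coeff T n j \<alpha> = 0" using b by (simp add: middle_coeff_def)
      moreover have "root_elt T n i j \<alpha> = 1\<^sub>m ?N + \<alpha> \<cdot>\<^sub>m munit ?N i j - \<alpha> \<cdot>\<^sub>m munit ?N (?b j) (?b i)"
        using False by (simp add: root_elt_def Let_def) (simp add: TypeB)
      ultimately show ?thesis by (simp add: s mc)
    qed
  next
    case TypeC
    have "j \<noteq> ?b j" using TypeC P(6) by (simp add: bar_def msize_def) presburger
    then have b: "middle_coeff T n j \<alpha> = 0" by (simp add: middle_coeff_def)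
    have s: "form_sign T n i = (1::'a)" using P by (simp add: form_sign_def)
    consider "j \<le> n" | "\<not> j \<le> n" "j < ?b i" | "\<not> j \<le> n" "j = ?b i" using P(3) by linarith
    then show ?thesis
    proof cases
      case 1
      then have "j \<noteq> ?b i" using P TypeC by (auto simp: bar_def msize_def)
      then have "mirror_coeff T n i j \<alpha> = \<alpha>" using 1 s by (simp add: mirror_coeff_def form_sign_def)
      moreover have "root_elt T n i j \<alpha> = 1\<^sub>m ?N + \<alpha> \<cdot>\<^sub>m munit ?N i j - \<alpha> \<cdot>\<^sub>m munit ?N (?b j) (?b i)"
        using 1 by (simp add: root_elt_def Let_def) (simp add: TypeC)
      ultimately show ?thesis by (simp add: b mc)
    next
      case 2
      then have "mirror_coeff T n i j \<alpha> = - \<alpha>" using s TypeC by (simp add: mirror_coeff_def form_sign_def)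
      moreover have "root_elt T n i j \<alpha> = 1\<^sub>m ?N + \<alpha> \<cdot>\<^sub>m munit ?N i j + \<alpha> \<cdot>\<^sub>m munit ?N (?b j) (?b i)"
        using 2 by (simp add: root_elt_def Let_def) (simp add: TypeC)
      moreover have "\<dots> = 1\<^sub>m ?N + \<alpha> \<cdot>\<^sub>m munit ?N i j - (- \<alpha>) \<cdot>\<^sub>m munit ?N (?b j) (?b i)"
        by (rule plus) (simp add: munit_carrier)
      ultimately show ?thesis by (simp add: b mc)
    next
      case 3
      then have "mirror_coeff T n i j \<alpha> = 0" by (simp add: mirror_coeff_def)
      moreover have "root_elt T n i j \<alpha> = 1\<^sub>m ?N + \<alpha> \<cdot>\<^sub>m munit ?N i j"
        using 3 by (simp add: root_elt_def Let_def) (simp add: TypeC)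
      ultimately show ?thesis by (simp add: b mc)
    qed
  next
    case TypeD
    have "j \<noteq> ?b j" using TypeD P(6) by (simp add: bar_def msize_def) presburger
    then have b: "middle_coeff T n j \<alpha> = 0" by (simp add: middle_coeff_def)
    have "j \<noteq> ?b i" using TypeD assms(1) by (auto simp: Pos_def Pcirc_def)
    then have "mirror_coeff T n i j \<alpha> = \<alpha>" using TypeD by (simp add: form_sign_def mirror_coeff_def)
    moreover have "root_elt T n i j \<alpha> = 1\<^sub>m ?N + \<alpha> \<cdot>\<^sub>m munit ?N i j - \<alpha> \<cdot>\<^sub>m munit ?N (?b j) (?b i)"
      by (simp add: root_elt_def Let_def) (simp add: TypeD)
    ultimately show ?thesis by (simp add: b mc)
  qed
qed

lemma ent_root_elt:
  assumes "(i, j) \<in> Pos T n" "a \<in> {1..msize T n}" "b \<in> {1..msize T n}"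
  shows "ent (root_elt T n i j \<alpha>) a b = (if a = b then 1 else 0) + (if a = i \<and> b = j then \<alpha> else 0)
    - (if a = bar T n j \<and> b = bar T n i then mirror_coeff T n i j \<alpha> else 0)
    - (if a = i \<and> b = bar T n i then middle_coeff T n j \<alpha> else 0)"
proof -
  have if_mult: "c * (if Q then 1 else 0) = (if Q then c else 0)" for c :: 'a and Q by simp
  have c: "1\<^sub>m (msize T n) \<in> carrier_mat (msize T n) (msize T n)" 
    "\<And>c u v. c \<cdot>\<^sub>m munit (msize T n) u v \<in> carrier_mat (msize T n) (msize T n)" 
    by (auto simp: munit_carrier)
  show ?thesis
    unfolding root_elt_eq[OF assms(1)] 
    by (simp only: ent_one[OF assms(2,3)] ent_add_minus_smult[OF assms(2,3)] ent_munit[OF assms(2,3)]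
      if_mult c munit_carrier)
qed

lemma root_elt_Utilde:
  assumes "(i, j) \<in> Pos T n"
  shows "root_elt T n i j \<alpha> \<in> carrier (Utilde (msize T n))"
proof -
  note b = Pos_bounds[OF assms]
  have "i < j" "bar T n j < bar T n i" "i < bar T n i" using b by (auto simp: bar_def)
  show ?thesis
    unfolding Utilde_carrier_iff
  proof (intro conjI ballI impI)
    fix a c assume ac: "a \<in> {1..msize T n}" "c \<in> {1..msize T n}" "c \<le> a"
    have "\<not> (a = i \<and> c = j)" "\<not> (a = bar T n j \<and> c = bar T n i)" "\<not> (a = i \<and> c = bar T n i)"
      using ac(3) \<open>i < j\<close> \<open>bar T n j < bar T n i\<close> \<open>i < bar T n i\<close> by auto
    then show "ent (root_elt T n i j \<alpha>) a c = (if a = c then 1 else 0)"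
      by (simp only: ent_root_elt[OF assms ac(1,2)] if_False add_0_right diff_zero)
  qed (rule root_elt_carrier)
qed

text \<open>
  The redundant condition \<open>P\<close> lets the four summands of a row of a root element be handled alike.
\<close>

lemma sum_single:
  fixes f :: "nat \<Rightarrow> 'a::semiring_0"
  assumes "c \<in> {1..N}"
  shows "(\<Sum>k=1..N. (if P \<and> k = c then v else 0) * f k) = (if P then v * f c else 0)"
proof (cases P)
  case True
  have "(\<Sum>k=1..N. (if P \<and> k = c then v else 0) * f k) = (\<Sum>k=1..N. if k = c then v * f k else 0)"
    using True by (intro sum.cong) auto
  then show ?thesis using assms True by simp
qed simp

lemma sum_root_elt_row:
  fixes f :: "nat \<Rightarrow> 'a::field"
  assumes P: "(i, j) \<in> Pos T n" and a: "a \<in> {1..msize T n}"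
  shows "(\<Sum>k=1..msize T n. ent (root_elt T n i j \<alpha>) a k * f k) = 
    f a + (if a = i then \<alpha> * f j else 0) 
    - (if a = bar T n j then mirror_coeff T n i j \<alpha> * f (bar T n i) else 0)
    - (if a = i then middle_coeff T n j \<alpha> * f (bar T n i) else 0)" (is "?l = ?r")
proof -
  note b = Pos_bounds[OF P]
  have "?l = (\<Sum>k=1..msize T n. (if True \<and> k = a then 1 else 0) * f k
    + (if a = i \<and> k = j then \<alpha> else 0) * f k
    - (if a = bar T n j \<and> k = bar T n i then mirror_coeff T n i j \<alpha> else 0) * f k
    - (if a = i \<and> k = bar T n i then middle_coeff T n j \<alpha> else 0) * f k)"
    unfolding left_diff_distrib[symmetric] distrib_right[symmetric]
  proof (intro sum.cong refl arg_cong2[where f = "(*)"], goal_cases)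
    case (1 k)
    then show ?case by (simp only: ent_root_elt[OF P a] simp_thms eq_commute[of a k])
  qed
  also have "\<dots> = ?r"
    unfolding sum.distrib sum_subtractf sum_single[OF a] sum_single[OF b(6)] sum_single[OF bar_in[OF b(5)]]
    by simp
  finally show ?thesis .
qed

section \<open>The invariant bilinear form\<close>

definition antiform :: "lie_type \<Rightarrow> nat \<Rightarrow> 'a::field mat" where
  "antiform T n = mat (msize T n) (msize T n) 
     (\<lambda>(r, c). if c + 1 = bar T n (r + 1) then form_sign T n (r + 1) else 0)"

definition isometric :: "lie_type \<Rightarrow> nat \<Rightarrow> 'a::field mat \<Rightarrow> bool" where
  "isometric T n w \<longleftrightarrow> w * antiform T n * transpose_mat w = antiform T n"

lemma antiform_carrier: "antiform T n \<in> carrier_mat (msize T n) (msize T n)"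
  by (simp add: antiform_def)

lemma ent_antiform:
  "a \<in> {1..msize T n} \<Longrightarrow> b \<in> {1..msize T n} \<Longrightarrow>
    ent (antiform T n) a b = (if b = bar T n a then form_sign T n a else 0)"
  by (auto simp: ent_def antiform_def)

lemma ent_mult_antiform:
  assumes "w \<in> carrier_mat (msize T n) (msize T n)" "a \<in> {1..msize T n}" "b \<in> {1..msize T n}"
  shows "ent (w * antiform T n) a b = ent w a (bar T n b) * form_sign T n (bar T n b)"
proof -
  have "ent (w * antiform T n) a b = (\<Sum>k=1..msize T n. ent w a k * ent (antiform T n) k b)"
    by (rule ent_mult[OF assms(1) antiform_carrier assms(2,3)])
  also have "\<dots> = (\<Sum>k=1..msize T n. if k = bar T n b then ent w a k * form_sign T n k else 0)"
  proof (intro sum.cong refl)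
    fix k assume k: "k \<in> {1..msize T n}"
    then have "b = bar T n k \<longleftrightarrow> k = bar T n b" using assms(3) by (auto simp: bar_def)
    then show "ent w a k * ent (antiform T n) k b = (if k = bar T n b then ent w a k * form_sign T n k else 0)"
      by (simp add: ent_antiform[OF k assms(3)])
  qed
  also have "\<dots> = ent w a (bar T n b) * form_sign T n (bar T n b)"
    using bar_in[OF assms(3)] by simp
  finally show ?thesis .
qed

text \<open>
  The rows of an isometry are, up to signs and order, dual to themselves: row \<open>a\<close> pairs to zero with all
  rows except row \<open>bar a\<close>.
\<close>

lemma isometric_iff:
  assumes w: "w \<in> carrier_mat (msize T n) (msize T n)"
  shows "isometric T n w \<longleftrightarrow> (\<forall>a\<in>{1..msize T n}. \<forall>b\<in>{1..msize T n}.
    (\<Sum>k=1..msize T n. ent w a k * (form_sign T n k * ent w b (bar T n k))) = (if b = bar T n a then form_sign T n a else 0))"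
    (is "_ \<longleftrightarrow> ?r")
proof -
  let ?N = "msize T n"
  have wJ: "w * antiform T n \<in> carrier_mat ?N ?N" by (rule mult_carrier_mat[OF w antiform_carrier])
  have wt: "transpose_mat w \<in> carrier_mat ?N ?N" using w by simp
  have e: "ent (w * antiform T n * transpose_mat w) a b
     = (\<Sum>k=1..?N. ent w a k * (form_sign T n k * ent w b (bar T n k)))"
    if "a \<in> {1..?N}" "b \<in> {1..?N}" for a b
  proof -
    have "ent (w * antiform T n * transpose_mat w) a b
      = (\<Sum>k=1..?N. ent w a (bar T n k) * form_sign T n (bar T n k) * ent w b k)"
      using that by (simp add: ent_mult[OF wJ wt] ent_mult_antiform[OF w] ent_transpose[OF w])
    also have "\<dots> = (\<Sum>k=1..?N. ent w a (bar T n (bar T n k)) * form_sign T n (bar T n (bar T n k)) * ent w b (bar T n k))"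
      by (rule sum_bar[symmetric])
    also have "\<dots> = (\<Sum>k=1..?N. ent w a k * (form_sign T n k * ent w b (bar T n k)))"
      by (intro sum.cong refl) (simp add: mult.assoc)
    finally show ?thesis .
  qed
  show ?thesis
  proof
    assume "isometric T n w"
    then have eq: "w * antiform T n * transpose_mat w = antiform T n" by (simp add: isometric_def)
    show ?r
    proof (intro ballI)
      fix a b assume ab: "a \<in> {1..?N}" "b \<in> {1..?N}"
      show "(\<Sum>k=1..?N. ent w a k * (form_sign T n k * ent w b (bar T n k))) = (if b = bar T n a then form_sign T n a else 0)"
        using e[OF ab] ent_antiform[OF ab] unfolding eq by (rule trans[OF sym])
    qed
  next
    assume r: ?r
    show "isometric T n w"
      unfolding isometric_def
    proof (rule eq_entI[where N = ?N])
      show "w * antiform T n * transpose_mat w \<in> carrier_mat ?N ?N" using wJ wt by simp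
      show "ent (w * antiform T n * transpose_mat w) a b = ent (antiform T n) a b"
        if "a \<in> {1..?N}" "b \<in> {1..?N}" for a b
        using r that by (simp only: e[OF that] ent_antiform[OF that])
    qed (rule antiform_carrier)
  qed
qed

lemma congruence_mult:
  assumes "v \<in> carrier_mat N N" "w \<in> carrier_mat N N" "J \<in> carrier_mat N N"
  shows "v * w * J * transpose_mat (v * w) = v * (w * J * transpose_mat w) * transpose_mat (v :: 'a::comm_semiring_1 mat)"
proof -
  have t: "transpose_mat v \<in> carrier_mat N N" "transpose_mat w \<in> carrier_mat N N" using assms by auto
  note c = assms(1,2) t assms(3) mult_carrier_mat[OF assms(1,2)] mult_carrier_mat[OF assms(2,3)]
    mult_carrier_mat[OF mult_carrier_mat[OF assms(1,2)] assms(3)]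
  have "v * w * J * transpose_mat (v * w) = v * w * J * (transpose_mat w * transpose_mat v)"
    by (simp only: transpose_mult[OF assms(1,2)])
  also have "\<dots> = v * w * J * transpose_mat w * transpose_mat v"
    by (rule assoc_mult_mat[symmetric, OF c(8) c(4) c(3)])
  also have "v * w * J * transpose_mat w = v * (w * J * transpose_mat w)"
    by (simp only: assoc_mult_mat[OF c(1,2,5)] assoc_mult_mat[OF c(1,7,4)])
  finally show ?thesis .
qed

lemma isometric_mult:
  assumes "v \<in> carrier_mat (msize T n) (msize T n)" "w \<in> carrier_mat (msize T n) (msize T n)"
    and "isometric T n v" "isometric T n w"
  shows "isometric T n (v * w)"
  using assms(3,4) congruence_mult[OF assms(1,2) antiform_carrier] by (simp add: isometric_def)

text \<open>
  Besides the diagonal terms, the pairing of two rows contains one term for each of the two entries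
  that mirror each other, and these two cancel by the choice of signs. In the middle column of type B
  the entry \<open>\<alpha>\<close> is also paired with its own mirror image; the result \<open>\<alpha>\<^sup>2\<close> is compensated by two copies of
  the quadratic term.
\<close>

lemma isometric_root_elt:
  fixes \<alpha> :: "'a::field"
  assumes P: "(i, j) \<in> Pos T n" and two: "(2::'a) \<noteq> 0"
  shows "isometric T n (root_elt T n i j \<alpha>)"
  unfolding isometric_iff[OF root_elt_carrier]
proof (intro ballI)
  let ?N = "msize T n" and ?x = "root_elt T n i j \<alpha>" and ?s = "form_sign T n :: nat \<Rightarrow> 'a"
  define i' j' \<beta> \<gamma> where "i' = bar T n i" and "j' = bar T n j" 
    and "\<beta> = mirror_coeff T n i j \<alpha>" and "\<gamma> = middle_coeff T n j \<alpha>"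
  note folds = i'_def[symmetric] j'_def[symmetric] \<beta>_def[symmetric] \<gamma>_def[symmetric]
  note b = Pos_bounds[OF P]
  fix a c assume a: "a \<in> {1..?N}" and c: "c \<in> {1..?N}"
  define d where "d = bar T n c"
  have d: "d \<in> {1..?N}" "c = bar T n d" using bar_in[OF c] bar_bar[OF c] by (simp_all add: d_def)
  define G where "G k = (if k = d then 1 else 0) + (if d = i' \<and> k = j' then \<alpha> else 0)
     - (if d = j \<and> k = i then \<beta> else 0) - (if d = i' \<and> k = i then \<gamma> else 0)" for k
  have G: "ent ?x c (bar T n k) = G k" if k: "k \<in> {1..?N}" for k
  proof -
    have "c = bar T n k \<longleftrightarrow> k = d" "c = i \<longleftrightarrow> d = i'" "bar T n k = j \<longleftrightarrow> k = j'" 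
      "c = j' \<longleftrightarrow> d = j" "bar T n k = i' \<longleftrightarrow> k = i" 
      using k c b by (auto simp: bar_def d_def i'_def j'_def)
    then show ?thesis unfolding ent_root_elt[OF P c bar_in[OF k]] folds G_def by simp
  qed
  have "(\<Sum>k=1..?N. ent ?x a k * (?s k * ent ?x c (bar T n k))) = (\<Sum>k=1..?N. ent ?x a k * (?s k * G k))"
    by (intro sum.cong refl) (simp add: G)
  also have "\<dots> = ?s a * G a + (if a = i then \<alpha> * (?s j * G j) else 0) 
    - (if a = j' then \<beta> * (?s i' * G i') else 0) - (if a = i then \<gamma> * (?s i' * G i') else 0)"
    unfolding sum_root_elt_row[OF P a] folds ..
  also have "\<dots> = (if a = d then ?s a else 0)"
  proof -
    have i: "i < j" "i \<noteq> i'" using b by (auto simp: i'_def bar_def)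
    consider "j = i'" "j' = i" | "j = j'" "j \<noteq> i'" | "j \<noteq> i'" "j \<noteq> j'" "j' \<noteq> i" "j' \<noteq> i'"
      using b by (auto simp: i'_def j'_def bar_def) linarith
    then show ?thesis
    proof cases
      case 1
      have "j \<noteq> bar T n j" using 1(2) i unfolding j'_def by simp
      then have "\<beta> = 0" "\<gamma> = 0" using 1(1) by (simp_all add: \<beta>_def \<gamma>_def mirror_coeff_def middle_coeff_def i'_def)
      moreover have "?s j = - ?s i" using 1 P b 
        by (auto simp: form_sign_def i'_def Pos_iff bar_def msize_def split: if_splits)
      ultimately show ?thesis using 1(2) i unfolding G_def 1(1)[symmetric] by auto
    next
      case 2
      have "j = msize T n + 1 - j" using 2(1) unfolding j'_def bar_def .
      then have "odd (msize T n)" using b(6) unfolding atLeastAtMost_iff by presburger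
      then have "T = TypeB" by (simp add: msize_def split: if_splits)
      then have s: "?s k = 1" for k by (simp add: form_sign_def)
      then have "\<beta> = \<alpha>" using 2 by (simp add: \<beta>_def mirror_coeff_def folds)
      moreover have "\<gamma> = (1/2) * \<alpha>\<^sup>2" 
        using 2(1) unfolding \<gamma>_def middle_coeff_def folds by (rule if_P)
      moreover from this have "\<alpha> * \<alpha> = \<gamma> + \<gamma>" using two by (simp add: power2_eq_square field_simps)
      ultimately show ?thesis using 2(2) i unfolding G_def s 2(1)[symmetric] 
        by (auto simp: algebra_simps)
    next
      case 3
      have "?s i' * ?s i = ?s j' * ?s j" "?s i = 1"
        using b 3 by (auto simp: form_sign_def i'_def j'_def bar_def msize_def split: if_splits)
      moreover have "\<gamma> = 0" "\<beta> = ?s i * ?s j * \<alpha>" using 3 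
        by (simp_all add: \<beta>_def \<gamma>_def mirror_coeff_def middle_coeff_def folds)
      moreover have "?s j * ?s j = 1" "?s j' * ?s j' = 1" by simp_all
      ultimately show ?thesis using 3 i unfolding G_def
        by (auto simp: algebra_simps)
    qed
  qed
  also have "a = d \<longleftrightarrow> c = bar T n a" using a c by (auto simp: d_def bar_def)
  finally show "(\<Sum>k=1..?N. ent ?x a k * (?s k * ent ?x c (bar T n k))) = (if c = bar T n a then ?s a else 0)" .
qed

section \<open>All unitriangular isometries belong to U\<close>

lemma subgroup_UU: "subgroup (carrier (UU T n)) (Utilde (msize T n) :: 'a::field mat monoid)"
proof -
  have "(\<Union>r\<in>Pos T n. root_subgroup T n r) \<subseteq> carrier (Utilde (msize T n) :: 'a mat monoid)"
    using root_elt_Utilde by (fastforce simp: root_subgroup_def)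
  from group.generate_is_subgroup[OF group_Utilde this] show ?thesis by (simp add: UU_def)
qed

lemma UU_eq: "UU T n = (Utilde (msize T n)) \<lparr> carrier := carrier (UU T n) \<rparr>"
  by (simp add: UU_def)

lemma group_UU: "group (UU T n :: 'a::field mat monoid)"
  by (subst UU_eq) (rule group.subgroup_imp_group[OF group_Utilde subgroup_UU])

lemma UU_simps [simp]:
  "A \<otimes>\<^bsub>UU T n\<^esub> B = A * B" "\<one>\<^bsub>UU T n\<^esub> = 1\<^sub>m (msize T n)"
  by (simp_all add: UU_def Utilde_def)

lemma UU_Utilde: "g \<in> carrier (UU T n) \<Longrightarrow> g \<in> carrier (Utilde (msize T n))"
  using subgroup.subset[OF subgroup_UU] by blast

lemma root_elt_UU: "(i, j) \<in> Pos T n \<Longrightarrow> root_elt T n i j \<alpha> \<in> carrier (UU T n)"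
  by (auto simp: UU_def root_subgroup_def intro!: generate.incl)

lemma UU_cancel_right:
  assumes "v \<in> carrier (Utilde (msize T n))" "x \<in> carrier (UU T n)" "v * x \<in> carrier (UU T n)"
  shows "v \<in> carrier (UU T n :: 'a::field mat monoid)"
proof -
  interpret G: group "Utilde (msize T n) :: 'a mat monoid" by (rule group_Utilde)
  interpret S: subgroup "carrier (UU T n)" "Utilde (msize T n) :: 'a mat monoid" by (rule subgroup_UU)
  have "v = (v \<otimes>\<^bsub>Utilde (msize T n)\<^esub> x) \<otimes>\<^bsub>Utilde (msize T n)\<^esub> inv\<^bsub>Utilde (msize T n)\<^esub> x"
    using assms(1,2) S.subset by (simp add: G.m_assoc subsetD del: Utilde_simps)
  also have "\<dots> \<in> carrier (UU T n)"
    using assms(2,3) S.m_closed[OF _ S.m_inv_closed] by simp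
  finally show ?thesis .
qed

text \<open>
  Pairing a trivial row \<open>a\<close> with row \<open>c\<close> extracts the entry of row \<open>c\<close> in column \<open>bar a\<close>.
\<close>

lemma isometric_column:
  assumes w: "w \<in> carrier_mat (msize T n) (msize T n)" "isometric T n w" 
    and a: "a \<in> {1..msize T n}" and c: "c \<in> {1..msize T n}"
    and row: "\<And>b. b \<in> {1..msize T n} \<Longrightarrow> ent w a b = (if a = b then 1 else 0)"
  shows "ent w c (bar T n a) = (if c = bar T n a then 1 else 0)"
proof -
  have "(if c = bar T n a then form_sign T n a else 0) = (\<Sum>k=1..msize T n. ent w a k * (form_sign T n k * ent w c (bar T n k)))"
    using w(2) a c by (simp add: isometric_iff[OF w(1)])
  also have "\<dots> = (\<Sum>k=1..msize T n. (if True \<and> k = a then 1 else 0) * (form_sign T n k * ent w c (bar T n k)))"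
    using row by (intro sum.cong) auto
  also have "\<dots> = form_sign T n a * ent w c (bar T n a)"
    unfolding sum_single[OF a] by simp
  finally show ?thesis by (simp split: if_splits)
qed

text \<open>
  Multiplication by \<open>x\<^sub>i\<^sub>j(\<alpha>)\<close> from the right changes only columns \<open>j\<close> and \<open>bar i\<close>, and column \<open>j\<close> by the
  plain column operation that adds \<open>\<alpha>\<close> times column \<open>i\<close>.
\<close>

lemma ent_root_elt_column:
  assumes P: "(i, j) \<in> Pos T n" and k: "k \<in> {1..msize T n}" "b \<in> {1..msize T n}"
    and b: "b \<noteq> bar T n i \<or> j = bar T n i"
  shows "ent (root_elt T n i j \<alpha>) k b = (if k = b then 1 else 0) + (if k = i \<and> b = j then \<alpha> else 0)"
proof -
  have "middle_coeff T n j \<alpha> = 0" "mirror_coeff T n i j \<alpha> = 0" if "j = bar T n i"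
  proof -
    have "bar T n j \<noteq> j" using that Pos_bounds[OF P] by (auto simp: bar_def)
    then show "middle_coeff T n j \<alpha> = 0" by (simp add: middle_coeff_def)
    show "mirror_coeff T n i j \<alpha> = 0" using that by (simp add: mirror_coeff_def)
  qed
  then show ?thesis unfolding ent_root_elt[OF P k] using b by force
qed

text \<open>
  The stages of the reduction of an isometry to the identity: the rows above \<open>t\<close> are those of the
  identity matrix, and row \<open>t\<close> is cleared between the diagonal and column \<open>j\<close>.
\<close>

definition rows_cleared :: "lie_type \<Rightarrow> nat \<Rightarrow> nat \<Rightarrow> nat \<Rightarrow> 'a::field mat \<Rightarrow> bool" where
  "rows_cleared T n t j w \<longleftrightarrow> w \<in> carrier (Utilde (msize T n)) \<and> isometric T n w \<and>
     (\<forall>a\<in>{1..<t}. \<forall>b\<in>{1..msize T n}. ent w a b = (if a = b then 1 else 0)) \<and>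
     (\<forall>b\<in>{1..msize T n}. t < b \<and> b < j \<longrightarrow> ent w t b = 0)"

lemma rows_cleared_step:
  assumes two: "(2::'a::field) \<noteq> 0" and P: "(t, j) \<in> Pos T n" and w: "rows_cleared T n t j (w :: 'a mat)"
  shows "rows_cleared T n t (Suc j) (w * root_elt T n t j (- ent w t j))"
proof -
  let ?x = "root_elt T n t j (- ent w t j)" and ?N = "msize T n"
  note b = Pos_bounds[OF P]
  have wU: "w \<in> carrier (Utilde ?N)" using w by (simp add: rows_cleared_def)
  note wc = Utilde_carrier_mat[OF wU] and xc = root_elt_carrier[of T n t j "- ent w t j"]
  have row: "ent (w * ?x) a c = (if a = c then 1 else 0)" if a: "a \<in> {1..<t}" and c: "c \<in> {1..?N}" for a c
  proof -
    have aN: "a \<in> {1..?N}" using a b by auto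
    have "ent (w * ?x) a c = (\<Sum>k=1..?N. (if True \<and> k = a then 1 else 0) * ent ?x k c)"
      unfolding ent_mult[OF wc xc aN c] using w a by (intro sum.cong refl) (auto simp: rows_cleared_def)
    also have "\<dots> = ent ?x a c" unfolding sum_single[OF aN] by simp
    also have "\<dots> = (if a = c then 1 else 0)"
    proof -
      have "a \<noteq> t" "a \<noteq> bar T n j" using a b by (auto simp: bar_def)
      then show ?thesis by (simp add: ent_root_elt[OF P aN c])
    qed
    finally show ?thesis .
  qed
  have "ent (w * ?x) t c = 0" if c: "c \<in> {1..?N}" "t < c" "c < Suc j" for c
  proof -
    have dis: "c \<noteq> bar T n t \<or> j = bar T n t" using c b by auto
    have "ent (w * ?x) t c = (\<Sum>k=1..?N. (if True \<and> k = c then 1 else 0) * ent w t k 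
        + (if c = j \<and> k = t then - ent w t j else 0) * ent w t k)"
      unfolding ent_mult[OF wc xc b(5) c(1)]
    proof (intro sum.cong refl)
      fix k assume k: "k \<in> {1..?N}"
      show "ent w t k * ent ?x k c = (if True \<and> k = c then 1 else 0) * ent w t k 
          + (if c = j \<and> k = t then - ent w t j else 0) * ent w t k"
        unfolding ent_root_elt_column[OF P k c(1) dis] by (simp add: distrib_left)
    qed
    also have "\<dots> = ent w t c + (if c = j then - ent w t j * ent w t t else 0)"
      unfolding sum.distrib sum_single[OF c(1)] sum_single[OF b(5)] by simp
    also have "\<dots> = 0"
      using w c Utilde_ent[OF wU b(5) b(5)] by (auto simp: rows_cleared_def less_Suc_eq)
    finally show ?thesis .
  qed
  moreover have "isometric T n (w * ?x)"
    using w by (intro isometric_mult[OF wc xc] isometric_root_elt[OF P two]) (simp add: rows_cleared_def)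
  ultimately show ?thesis
    using row Utilde_mult_closed[OF wU root_elt_Utilde[OF P]] by (simp add: rows_cleared_def)
qed

text \<open>
  Beyond the antidiagonal, and in types B and D also on it, no root element is available, but there the
  entries of a cleared row vanish by themselves: beyond it because the earlier rows are trivial, on it
  because row \<open>t\<close> is isotropic and its entry there is counted twice.
\<close>

lemma rows_cleared_step_outside:
  assumes two: "(2::'a::field) \<noteq> 0" and P: "(t, j) \<notin> Pos T n" and t: "1 \<le> t" "t \<le> n" 
    and j: "j \<le> msize T n" and w: "rows_cleared T n t j (w :: 'a mat)"
  shows "rows_cleared T n t (Suc j) w"
proof -
  let ?N = "msize T n"
  have wU: "w \<in> carrier (Utilde ?N)" and iso: "isometric T n w" using w by (auto simp: rows_cleared_def)
  note wc = Utilde_carrier_mat[OF wU]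
  have tN: "t \<in> {1..?N}" using t by (auto simp: msize_def)
  have far: "ent w t c = 0" if "bar T n t < c" "c \<le> ?N" for c
  proof -
    have c: "bar T n c \<in> {1..<t}" "bar T n (bar T n c) = c" "c \<noteq> t" 
      using that t by (auto simp: bar_def msize_def split: if_splits)
    have "ent w t (bar T n (bar T n c)) = (if t = bar T n (bar T n c) then 1 else 0)"
      using w c tN by (intro isometric_column[OF wc iso]) (auto simp: rows_cleared_def)
    then show ?thesis using c by simp
  qed
  have "ent w t j = 0" if "t < j"
  proof (cases "j = bar T n t")
    case False
    then show ?thesis using P far[of j] j that t by (simp add: Pos_iff split: if_splits)
  next
    case True
    then have "T \<noteq> TypeC" using P that t by (auto simp: Pos_iff)
    then have s: "form_sign T n k = (1::'a)" for k by (simp add: form_sign_def)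
    have jb: "bar T n j = t" "j \<in> {1..?N}" "t \<noteq> j" using True tN that j by auto
    have "0 = (\<Sum>k=1..?N. ent w t k * (form_sign T n k * ent w t (bar T n k)))"
    proof -
      have "t \<noteq> bar T n t" using that True by simp
      then show ?thesis using iso tN by (simp add: isometric_iff[OF wc])
    qed
    also have "\<dots> = (\<Sum>k\<in>{t, j}. ent w t k * (form_sign T n k * ent w t (bar T n k)))"
    proof (rule sum.mono_neutral_right)
      show "\<forall>k\<in>{1..?N} - {t, j}. ent w t k * (form_sign T n k * ent w t (bar T n k)) = 0"
      proof
        fix k assume k: "k \<in> {1..?N} - {t, j}"
        then consider "k < t" | "t < k" "k < j" | "j < k" by fastforce
        then have "ent w t k = 0"
        proof cases
          case 1
          then show ?thesis using Utilde_ent[OF wU tN, of k] k by auto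
        next
          case 2
          then show ?thesis using w k by (simp add: rows_cleared_def)
        next
          case 3
          then show ?thesis using far[of k] k True by simp
        qed
        then show "ent w t k * (form_sign T n k * ent w t (bar T n k)) = 0" by simp
      qed
    qed (use jb tN in auto)
    also have "\<dots> = 2 * ent w t j"
      using jb True[symmetric] Utilde_ent[OF wU tN tN] by (simp add: s)
    finally show ?thesis using two by simp
  qed
  then show ?thesis using w by (auto simp: rows_cleared_def less_Suc_eq)
qed

text \<open>
  Gaussian elimination by root elements from the right, one row after the other. Rows \<open>1, \<dots>, n\<close>
  suffice, since a unitriangular isometry in which they are trivial is the identity.
\<close>

lemma isometric_in_UU:
  assumes two: "(2::'a::field) \<noteq> 0" and w: "w \<in> carrier (Utilde (msize T n))" "isometric T n (w :: 'a mat)"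
  shows "w \<in> carrier (UU T n)"
proof -
  let ?N = "msize T n"
  interpret U: group "UU T n :: 'a mat monoid" by (rule group_UU)
  have last: "v = 1\<^sub>m ?N" if v: "rows_cleared T n (Suc n) 0 (v :: 'a mat)" for v
  proof (rule eq_entI[where N = ?N])
    have vU: "v \<in> carrier (Utilde ?N)" and iso: "isometric T n v" using v by (auto simp: rows_cleared_def)
    show vc: "v \<in> carrier_mat ?N ?N" by (rule Utilde_carrier_mat[OF vU])
    fix a b assume a: "a \<in> {1..?N}" and b: "b \<in> {1..?N}"
    have row: "ent v a b = (if a = b then 1 else 0)" if "a \<le> n" "a \<in> {1..?N}" "b \<in> {1..?N}" for a b
      using v that by (simp add: rows_cleared_def)
    have "ent v a b = (if a = b then 1 else 0)"
    proof -
      consider "a \<le> n" | "b \<le> a" | "n < a" "a < b" by linarith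
      then show ?thesis
      proof cases
        case 3
        then have c: "bar T n b \<le> n" using b by (auto simp: bar_def msize_def)
        have "ent v a (bar T n (bar T n b)) = (if a = bar T n (bar T n b) then 1 else 0)"
          by (rule isometric_column[OF vc iso bar_in[OF b] a row[OF c bar_in[OF b]]])
        then show ?thesis unfolding bar_bar[OF b] .
      qed (use row a b Utilde_ent[OF vU a b] in auto)
    qed
    then show "ent v a b = ent (1\<^sub>m ?N) a b" by (simp add: ent_one[OF a b])
  qed simp
  have row: "v \<in> carrier (UU T n)" 
    if next_row: "\<And>v :: 'a mat. rows_cleared T n (Suc t) 0 v \<Longrightarrow> v \<in> carrier (UU T n)" and t: "1 \<le> t" "t \<le> n" 
      and "j \<le> Suc ?N" and "rows_cleared T n t j (v :: 'a mat)" for t j v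
    using \<open>j \<le> Suc ?N\<close> \<open>rows_cleared T n t j v\<close>
  proof (induction "Suc ?N - j" arbitrary: j v)
    case 0
    then have j: "j = Suc ?N" by simp
    have tN: "t \<in> {1..?N}" using t by (auto simp: msize_def)
    have vU: "v \<in> carrier (Utilde ?N)" using 0 by (auto simp: rows_cleared_def)
    have "ent v t b = (if t = b then 1 else 0)" if "b \<in> {1..?N}" for b
      using 0(3) j that Utilde_ent[OF vU tN that] unfolding rows_cleared_def by (cases "b \<le> t") auto
    then have "rows_cleared T n (Suc t) 0 v" using 0(3) by (auto simp: rows_cleared_def less_Suc_eq)
    then show ?case by (rule next_row)
  next
    case (Suc d)
    then have j: "j \<le> ?N" "d = Suc ?N - Suc j" by simp_all
    show ?case
    proof (cases "(t, j) \<in> Pos T n")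
      case True
      let ?x = "root_elt T n t j (- ent v t j)"
      have "v * ?x \<in> carrier (UU T n)"
        using Suc.hyps(1)[OF j(2)] j(1) rows_cleared_step[OF two True Suc.prems(2)] by simp
      moreover have "v \<in> carrier (Utilde ?N)" using Suc.prems by (simp add: rows_cleared_def)
      ultimately show ?thesis using UU_cancel_right root_elt_UU[OF True] by blast
    next
      case False
      then show ?thesis
        using Suc.hyps(1)[OF j(2)] j(1) rows_cleared_step_outside[OF two False t j(1) Suc.prems(2)] by simp
    qed
  qed
  have "v \<in> carrier (UU T n)" if "1 \<le> t" "t \<le> Suc n" "rows_cleared T n t 0 (v :: 'a mat)" for t v
    using that
  proof (induction "Suc n - t" arbitrary: t v)
    case 0
    then have "v = 1\<^sub>m ?N" using last by simp
    then show ?case using U.one_closed by simp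
  next
    case (Suc d)
    show ?case
    proof (rule row[of t 0])
      show "v \<in> carrier (UU T n)" if "rows_cleared T n (Suc t) 0 v" for v :: "'a mat"
        using Suc.hyps(1)[of "Suc t" v] Suc.hyps(2) Suc.prems that by simp
    qed (use Suc in simp_all)
  qed
  from this[of 1 w] w show ?thesis by (simp add: rows_cleared_def)
qed

section \<open>The Cayley transform\<close>

lemma ent_antiform_mult:
  assumes "w \<in> carrier_mat (msize T n) (msize T n)" "a \<in> {1..msize T n}" "b \<in> {1..msize T n}"
  shows "ent (antiform T n * w) a b = form_sign T n a * ent w (bar T n a) b"
proof -
  have "ent (antiform T n * w) a b = (\<Sum>k=1..msize T n. ent (antiform T n) a k * ent w k b)"
    by (rule ent_mult[OF antiform_carrier assms(1-3)])
  also have "\<dots> = (\<Sum>k=1..msize T n. (if True \<and> k = bar T n a then form_sign T n a else 0) * ent w k b)"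
    by (intro sum.cong refl) (simp add: ent_antiform[OF assms(2)])
  also have "\<dots> = form_sign T n a * ent w (bar T n a) b"
    unfolding sum_single[OF bar_in[OF assms(2)]] by simp
  finally show ?thesis .
qed

text \<open>
  The condition on the entries says that \<open>w\<close> is the adjoint of \<open>v\<close> with respect to the form.
\<close>

lemma mult_antiform_eq:
  assumes v: "v \<in> carrier_mat (msize T n) (msize T n)" and w: "w \<in> carrier_mat (msize T n) (msize T n)"
    and eq: "\<And>a b. a \<in> {1..msize T n} \<Longrightarrow> b \<in> {1..msize T n} \<Longrightarrow> 
      ent w (bar T n b) (bar T n a) = form_sign T n a * form_sign T n b * ent v a b"
  shows "v * antiform T n = antiform T n * transpose_mat w"
proof (rule eq_entI[where N = "msize T n"])
  have wt: "transpose_mat w \<in> carrier_mat (msize T n) (msize T n)" using w by simp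
  show "v * antiform T n \<in> carrier_mat (msize T n) (msize T n)" by (rule mult_carrier_mat[OF v antiform_carrier])
  show "antiform T n * transpose_mat w \<in> carrier_mat (msize T n) (msize T n)"
    by (rule mult_carrier_mat[OF antiform_carrier wt])
  fix a b assume a: "a \<in> {1..msize T n}" and b: "b \<in> {1..msize T n}"
  have "form_sign T n a * ent w b (bar T n a) = form_sign T n a * ent w (bar T n (bar T n b)) (bar T n a)"
    by (simp only: bar_bar[OF b])
  also have "\<dots> = (form_sign T n a * form_sign T n a) * (form_sign T n (bar T n b) * ent v a (bar T n b))"
    unfolding eq[OF a bar_in[OF b]] by (simp only: mult_ac)
  finally show "ent (v * antiform T n) a b = ent (antiform T n * transpose_mat w) a b"
    by (simp add: ent_mult_antiform[OF v a b] ent_antiform_mult[OF wt a b] ent_transpose[OF w bar_in[OF a] b] mult.commute)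
qed

text \<open>
  For skew \<open>z\<close> the matrices \<open>1 + z\<close> and \<open>1 - z\<close> are adjoint to each other and commute, so that
  \<open>(1 - z)\<inverse>(1 + z)\<close> is an isometry. It is characterised by \<open>w = 1 + z + w z\<close>, which is the form in which it
  is used.
\<close>

lemma cayley:
  fixes z :: "nat \<Rightarrow> nat \<Rightarrow> 'a::field"
  assumes two: "(2::'a) \<noteq> 0"
    and upper: "\<And>i j. j \<le> i \<Longrightarrow> z i j = 0"
    and skew: "\<And>i j. i \<in> {1..msize T n} \<Longrightarrow> j \<in> {1..msize T n} \<Longrightarrow> 
      z (bar T n j) (bar T n i) = - (form_sign T n i * form_sign T n j * z i j)"
  obtains w where "w \<in> carrier (UU T n)"
    and "\<And>i j. i \<in> {1..msize T n} \<Longrightarrow> j \<in> {1..msize T n} \<Longrightarrow> 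
      ent w i j = (if i = j then 1 else 0) + z i j + (\<Sum>k=1..msize T n. ent w i k * z k j)"
proof -
  let ?N = "msize T n" and ?J = "antiform T n"
  define Z where "Z = mat ?N ?N (\<lambda>(r, c). z (r + 1) (c + 1))"
  have Zc: "Z \<in> carrier_mat ?N ?N" by (simp add: Z_def)
  have entZ: "ent Z i j = z i j" if "i \<in> {1..?N}" "j \<in> {1..?N}" for i j
    using that by (auto simp: ent_def Z_def)
  define P where "P = 1\<^sub>m ?N + Z"
  define M where "M = 1\<^sub>m ?N - Z"
  have Pc: "P \<in> carrier_mat ?N ?N" and Mc: "M \<in> carrier_mat ?N ?N" using Zc by (auto simp: P_def M_def)
  have entP: "ent P i j = (if i = j then 1 else 0) + z i j" 
    and entM: "ent M i j = (if i = j then 1 else 0) - z i j" if "i \<in> {1..?N}" "j \<in> {1..?N}" for i j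
    unfolding P_def M_def ent_add_minus_smult(1,2)[OF that Zc] ent_one[OF that] entZ[OF that] by simp_all
  have PU: "P \<in> carrier (Utilde ?N)" and MU: "M \<in> carrier (Utilde ?N)"
    using Pc Mc upper by (auto simp: Utilde_carrier_iff entP entM)
  obtain V where V: "V \<in> carrier (Utilde ?N)" "V * M = 1\<^sub>m ?N" using Utilde_left_inverse[OF MU] by blast
  note Vc = Utilde_carrier_mat[OF V(1)]
  note Jc = antiform_carrier[of T n]
  have PM: "P * M = M * P"
  proof -
    have one: "1\<^sub>m ?N \<in> carrier_mat ?N ?N" by simp
    have "P * M = M + (Z - Z * Z)"
      unfolding P_def add_mult_distrib_mat[OF one Zc Mc] 
      unfolding M_def mult_minus_distrib_mat[OF Zc one Zc] using Zc by simp
    moreover have "M * P = M + (Z - Z * Z)"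
      unfolding P_def mult_add_distrib_mat[OF Mc one Zc] 
      unfolding M_def minus_mult_distrib_mat[OF one Zc Zc] using Zc by simp
    ultimately show ?thesis by simp
  qed
  define w where "w = V * P"
  have wU: "w \<in> carrier (Utilde ?N)" unfolding w_def by (rule Utilde_mult_closed[OF V(1) PU])
  note wc = Utilde_carrier_mat[OF wU]
  have wM: "w * M = P"
  proof -
    have "w * M = V * (P * M)" unfolding w_def by (rule assoc_mult_mat[OF Vc Pc Mc])
    also have "\<dots> = V * M * P" unfolding PM by (rule assoc_mult_mat[OF Vc Mc Pc, symmetric])
    finally show ?thesis using V(2) Pc by simp
  qed
  have mirror: "ent M (bar T n b) (bar T n a) = form_sign T n a * form_sign T n b * ent P a b" 
    "ent P (bar T n b) (bar T n a) = form_sign T n a * form_sign T n b * ent M a b"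
    if a: "a \<in> {1..?N}" and b: "b \<in> {1..?N}" for a b
  proof -
    have "bar T n b = bar T n a \<longleftrightarrow> a = b" using a b by (auto simp: bar_def)
    then show "ent M (bar T n b) (bar T n a) = form_sign T n a * form_sign T n b * ent P a b" 
      and "ent P (bar T n b) (bar T n a) = form_sign T n a * form_sign T n b * ent M a b"
      unfolding entP[OF a b] entM[OF a b] entP[OF bar_in[OF b] bar_in[OF a]] 
        entM[OF bar_in[OF b] bar_in[OF a]] skew[OF a b]
      by (simp_all add: distrib_left right_diff_distrib)
  qed
  have PJ: "P * ?J = ?J * transpose_mat M" by (rule mult_antiform_eq[OF Pc Mc mirror(1)])
  have MJ: "M * ?J = ?J * transpose_mat P" by (rule mult_antiform_eq[OF Mc Pc mirror(2)])
  have tc: "transpose_mat P \<in> carrier_mat ?N ?N" "transpose_mat M \<in> carrier_mat ?N ?N" using Pc Mc by auto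
  have key: "P * ?J * transpose_mat P = M * ?J * transpose_mat M"
    unfolding assoc_mult_mat[OF Pc Jc tc(1)] assoc_mult_mat[OF Mc Jc tc(2)] PJ[symmetric] MJ[symmetric]
      assoc_mult_mat[OF Pc Mc Jc, symmetric] assoc_mult_mat[OF Mc Pc Jc, symmetric] PM ..
  have iso: "isometric T n w"
    unfolding isometric_def w_def congruence_mult[OF Vc Pc Jc] key congruence_mult[OF Vc Mc Jc, symmetric] V(2)
    by (simp add: left_mult_one_mat[OF Jc] right_mult_one_mat[OF Jc])
  have eq: "ent w i j = (if i = j then 1 else 0) + z i j + (\<Sum>k=1..msize T n. ent w i k * z k j)"
    if i: "i \<in> {1..?N}" and j: "j \<in> {1..?N}" for i j
  proof -
    have "ent P i j = (\<Sum>k=1..?N. ent w i k * ent M k j)"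
      unfolding wM[symmetric] by (rule ent_mult[OF wc Mc i j])
    also have "\<dots> = (\<Sum>k=1..?N. (if True \<and> k = j then 1 else 0) * ent w i k - ent w i k * z k j)"
    proof (intro sum.cong refl)
      fix k assume "k \<in> {1..?N}"
      then show "ent w i k * ent M k j = (if True \<and> k = j then 1 else 0) * ent w i k - ent w i k * z k j"
        by (simp add: entM[OF _ j] right_diff_distrib)
    qed
    also have "\<dots> = ent w i j - (\<Sum>k=1..?N. ent w i k * z k j)"
      unfolding sum_subtractf sum_single[OF j] by simp
    finally show ?thesis by (simp add: entP[OF i j] algebra_simps)
  qed
  show ?thesis using that[OF isometric_in_UU[OF two wU iso] eq] .
qed

section \<open>Characters and their stabilisers\<close>

text \<open>
  Translation by 1 permutes the field, so summing all elements in two ways shows that the number of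
  elements is zero in the field; an odd number cannot vanish where 2 does.
\<close>

lemma two_neq_zero:
  assumes "odd (CARD('a::{field, finite}))"
  shows "(2::'a) \<noteq> 0"
proof
  assume two: "(2::'a) = 0"
  have "(\<Sum>x\<in>(UNIV::'a set). x) = (\<Sum>x\<in>(UNIV::'a set). x + 1)"
    by (rule sum.reindex_bij_witness[of _ "\<lambda>x. x + 1" "\<lambda>x. x - 1"]) auto
  then have z: "of_nat (CARD('a)) = (0::'a)" by (simp add: sum.distrib)
  obtain m where "CARD('a) = 2 * m + 1" using assms by (rule oddE)
  with z have "2 * of_nat m + 1 = (0::'a)" by (metis of_nat_add of_nat_mult of_nat_numeral of_nat_1)
  then show False using two by simp
qed

lemma kappa_eq:
  fixes A B :: "'a::comm_semiring_0 mat"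
  assumes "A \<in> carrier_mat N N" "B \<in> carrier_mat N N"
  shows "kappa A B = (\<Sum>j=1..N. \<Sum>i=1..N. ent A i j * ent B i j)"
proof -
  have t: "transpose_mat A \<in> carrier_mat N N" using assms by simp
  have "kappa A B = (\<Sum>j=1..N. ent (transpose_mat A * B) j j)"
    using assms by (simp add: kappa_def Let_def ent_def sum.atLeast1_atMost_eq[unfolded One_nat_def] One_nat_def)
  also have "\<dots> = (\<Sum>j=1..N. \<Sum>i=1..N. ent A i j * ent B i j)"
  proof (intro sum.cong refl)
    fix j assume j: "j \<in> {1..N}"
    show "ent (transpose_mat A * B) j j = (\<Sum>i=1..N. ent A i j * ent B i j)"
      unfolding ent_mult[OF t assms(2) j j]
      by (intro sum.cong refl) (simp add: ent_transpose[OF assms(1) j])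
  qed
  finally show ?thesis .
qed

lemma VV_iff: "A \<in> VV T n \<longleftrightarrow> A \<in> carrier_mat (msize T n) (msize T n) \<and>
    (\<forall>i\<in>{1..msize T n}. \<forall>j\<in>{1..msize T n}. (i, j) \<notin> Pos T n \<longrightarrow> ent A i j = 0)"
  unfolding VV_def supp_def by blast

lemma proj_carrier: "proj T n M \<in> carrier_mat (msize T n) (msize T n)"
  by (simp add: proj_def)

lemma ent_proj:
  "i \<in> {1..msize T n} \<Longrightarrow> j \<in> {1..msize T n} \<Longrightarrow> 
    ent (proj T n M) i j = (if (i, j) \<in> Pos T n then ent M i j else 0)"
  by (auto simp: ent_def proj_def)

lemma proj_VV: "proj T n M \<in> VV T n"
  by (simp add: VV_iff proj_carrier ent_proj)

text \<open>
  As \<open>c\<close> varies, \<open>c (x - y)\<close> takes every value unless \<open>x = y\<close>.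
\<close>

lemma character_separates:
  assumes "nontrivial_character \<theta>" and eq: "\<And>c. \<theta> (c * x) = \<theta> (c * y)"
  shows "x = y"
proof (rule ccontr)
  assume "x \<noteq> y"
  have "\<theta> t = 1" for t
  proof -
    define c where "c = t / (x - y)"
    have "c * x = t + c * y" using \<open>x \<noteq> y\<close> by (simp add: c_def field_simps)
    then have "\<theta> (c * x) = \<theta> t * \<theta> (c * y)" 
      using assms(1) by (simp add: nontrivial_character_def)
    then show ?thesis using eq[of c] assms(1) by (simp add: nontrivial_character_def)
  qed
  then show False using assms(1) by (auto simp: nontrivial_character_def)
qed

lemma ent_uminus:
  assumes "A \<in> carrier_mat N N" "i \<in> {1..N}" "j \<in> {1..N}"
  shows "ent (- A) i j = - ent A i j"
  using assms by (auto simp: ent_def)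

lemma ent_smult_munit:
  assumes "a \<in> {1..N}" "b \<in> {1..N}"
  shows "ent (c \<cdot>\<^sub>m munit N i j) a b = (if b = j \<and> a = i then c else 0 :: 'a::field)"
  unfolding ent_add_minus_smult(3)[OF assms munit_carrier] ent_munit[OF assms] by auto

lemma inj_on_chr:
  fixes \<theta> :: "'a::field \<Rightarrow> complex"
  assumes \<theta>: "nontrivial_character \<theta>"
  shows "inj_on (chr \<theta> T n) (VV T n)"
proof (rule inj_onI)
  let ?N = "msize T n"
  fix A B assume A: "A \<in> VV T n" and B: "B \<in> VV T n" and eq: "chr \<theta> T n A = chr \<theta> T n B"
  have Ac: "A \<in> carrier_mat ?N ?N" and Bc: "B \<in> carrier_mat ?N ?N" using A B by (auto simp: VV_iff)
  show "A = B"
  proof (rule eq_entI[OF Ac Bc])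
    fix i j assume i: "i \<in> {1..?N}" and j: "j \<in> {1..?N}"
    show "ent A i j = ent B i j"
    proof (cases "(i, j) \<in> Pos T n")
      case False
      then show ?thesis using A B i j by (simp add: VV_iff)
    next
      case True
      have k: "kappa (- C) (c \<cdot>\<^sub>m munit ?N i j) = (- c) * ent C i j" if C: "C \<in> carrier_mat ?N ?N" for c and C :: "'a mat"
      proof -
        have "kappa (- C) (c \<cdot>\<^sub>m munit ?N i j) 
            = (\<Sum>b=1..?N. \<Sum>a=1..?N. ent (- C) a b * ent (c \<cdot>\<^sub>m munit ?N i j) a b)"
          using C by (intro kappa_eq) (auto simp: munit_carrier)
        also have "\<dots> = (\<Sum>b=1..?N. \<Sum>a=1..?N. (if b = j \<and> a = i then - c else 0) * ent C a b)"
          by (intro sum.cong refl) (simp only: ent_uminus[OF C] ent_smult_munit, simp)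
        also have "\<dots> = (\<Sum>b=1..?N. (if True \<and> b = j then - c else 0) * ent C i b)"
          unfolding sum_single[OF i] by (intro sum.cong refl) simp
        also have "\<dots> = (- c) * ent C i j" unfolding sum_single[OF j] by simp
        finally show ?thesis .
      qed
      have "\<theta> (c * ent A i j) = \<theta> (c * ent B i j)" for c
      proof -
        have M: "(- c) \<cdot>\<^sub>m munit ?N i j \<in> VV T n" 
          using True by (auto simp: VV_iff munit_carrier ent_smult_munit)
        have "chr \<theta> T n A ((- c) \<cdot>\<^sub>m munit ?N i j) = chr \<theta> T n B ((- c) \<cdot>\<^sub>m munit ?N i j)"
          by (simp only: eq)
        then show ?thesis using M by (simp add: chr_def k[OF Ac] k[OF Bc])
      qed
      then show ?thesis by (rule character_separates[OF \<theta>])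
    qed
  qed
qed

lemma rep_chr:
  assumes "nontrivial_character \<theta>" "A \<in> VV T n"
  shows "rep \<theta> T n (chr \<theta> T n A) = A"
  unfolding rep_def by (rule the_inv_into_f_f[OF inj_on_chr[OF assms(1)] assms(2)])

text \<open>
  The action and \<open>\<Psi>\<^sub>A\<close> both involve the inverse of the group element, so at \<open>w\<inverse>\<close> they are expressed by the
  entries of \<open>w\<close> itself.
\<close>

lemma stab_Psi_inverse:
  assumes \<theta>: "nontrivial_character \<theta>" and A: "A \<in> VV T n" and w: "w \<in> carrier (UU T n)"
    and fixed: "\<And>i j. (i, j) \<in> Pos T n \<Longrightarrow> (\<Sum>k=1..msize T n. ent A i k * ent w j k) = ent A i j"
  shows "inv\<^bsub>UU T n\<^esub> w \<in> Stab \<theta> T n (chr \<theta> T n A)"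
    and "Psi \<theta> T n A (inv\<^bsub>UU T n\<^esub> w) = \<theta> (- (\<Sum>i=1..msize T n. \<Sum>j=1..msize T n. ent A i j * ent w i j))"
proof -
  let ?N = "msize T n" and ?u = "inv\<^bsub>UU T n\<^esub> w"
  interpret U: group "UU T n" by (rule group_UU)
  have u: "?u \<in> carrier (UU T n)" "inv\<^bsub>UU T n\<^esub> ?u = w" using w by simp_all
  note wc = Utilde_carrier_mat[OF UU_Utilde[OF w]]
  have Ac: "A \<in> carrier_mat ?N ?N" using A by (simp add: VV_iff)
  have tc: "transpose_mat w \<in> carrier_mat ?N ?N" using wc by simp
  have "proj T n (A * transpose_mat w) = A"
  proof (rule eq_entI[OF proj_carrier Ac])
    fix i j assume i: "i \<in> {1..?N}" and j: "j \<in> {1..?N}"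
    have "ent (A * transpose_mat w) i j = (\<Sum>k=1..?N. ent A i k * ent w j k)"
      unfolding ent_mult[OF Ac tc i j] by (intro sum.cong refl) (simp add: ent_transpose[OF wc _ j])
    then show "ent (proj T n (A * transpose_mat w)) i j = ent A i j"
      using fixed A i j by (simp add: ent_proj VV_iff)
  qed
  then have "ract \<theta> T n (chr \<theta> T n A) ?u = chr \<theta> T n A"
    by (simp add: ract_def rep_chr[OF \<theta> A] inv_tr_def u(2))
  then show st: "?u \<in> Stab \<theta> T n (chr \<theta> T n A)" using u(1) by (simp add: Stab_def)
  have "kappa (- A) (proj T n w) = (\<Sum>j=1..?N. \<Sum>i=1..?N. ent (- A) i j * ent (proj T n w) i j)"
    using Ac by (intro kappa_eq proj_carrier) simp
  also have "\<dots> = (\<Sum>j=1..?N. \<Sum>i=1..?N. - (ent A i j * ent w i j))"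
    using A by (intro sum.cong refl) (auto simp: ent_uminus[OF Ac] ent_proj VV_iff)
  also have "\<dots> = - (\<Sum>i=1..?N. \<Sum>j=1..?N. ent A i j * ent w i j)"
    by (subst sum.swap) (simp add: sum_negf)
  finally show "Psi \<theta> T n A ?u = \<theta> (- (\<Sum>i=1..?N. \<Sum>j=1..?N. ent A i j * ent w i j))"
    using st by (simp add: Psi_def u(2))
qed

text \<open>
  Substitute \<open>w = 1 + z + w z\<close>. In the product \<open>w z\<close> only rows \<open>l \<ge> j\<close> of \<open>z\<close> occur, and those
  with \<open>l > i\<close> are orthogonal to \<open>a\<close>; what remains is a second copy of the pairing with row \<open>j\<close> of \<open>z\<close>.
\<close>

lemma cayley_pairing:
  fixes z :: "nat \<Rightarrow> nat \<Rightarrow> 'a::field"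
  assumes w: "w \<in> carrier (Utilde N)"
    and cay: "\<And>i j. i \<in> {1..N} \<Longrightarrow> j \<in> {1..N} \<Longrightarrow> 
      ent w i j = (if i = j then 1 else 0) + z i j + (\<Sum>k=1..N. ent w i k * z k j)"
    and kills: "\<And>j. j \<in> {1..N} \<Longrightarrow> i < j \<Longrightarrow> (\<Sum>k=1..N. a k * z j k) = 0"
    and j: "j \<in> {1..N}" "i \<le> j"
  shows "(\<Sum>k=1..N. a k * ent w j k) = a j + 2 * (\<Sum>k=1..N. a k * z j k)"
proof -
  have "(\<Sum>k=1..N. a k * ent w j k) = (\<Sum>k=1..N. (if True \<and> k = j then 1 else 0) * a k + a k * z j k 
      + (\<Sum>l=1..N. ent w j l * (a k * z l k)))"
  proof (intro sum.cong refl)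
    fix k assume k: "k \<in> {1..N}"
    have "a k * ent w j k = a k * (if j = k then 1 else 0) + a k * z j k + a k * (\<Sum>l=1..N. ent w j l * z l k)"
      by (subst cay[OF j(1) k]) (simp only: distrib_left)
    also have "a k * (\<Sum>l=1..N. ent w j l * z l k) = (\<Sum>l=1..N. ent w j l * (a k * z l k))"
      by (simp add: sum_distrib_left mult_ac)
    also have "a k * (if j = k then 1 else 0) = (if True \<and> k = j then 1 else 0) * a k" by auto
    finally show "a k * ent w j k = (if True \<and> k = j then 1 else 0) * a k + a k * z j k 
      + (\<Sum>l=1..N. ent w j l * (a k * z l k))" .
  qed
  also have "\<dots> = a j + (\<Sum>k=1..N. a k * z j k) + (\<Sum>k=1..N. \<Sum>l=1..N. ent w j l * (a k * z l k))"
    unfolding sum.distrib sum_single[OF j(1)] by simp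
  also have "(\<Sum>k=1..N. \<Sum>l=1..N. ent w j l * (a k * z l k)) = (\<Sum>l=1..N. ent w j l * (\<Sum>k=1..N. a k * z l k))"
    by (subst sum.swap) (simp add: sum_distrib_left)
  also have "\<dots> = (\<Sum>l=1..N. (if True \<and> l = j then 1 else 0) * (\<Sum>k=1..N. a k * z l k))"
  proof (intro sum.cong refl)
    fix l assume l: "l \<in> {1..N}"
    show "ent w j l * (\<Sum>k=1..N. a k * z l k) = (if True \<and> l = j then 1 else 0) * (\<Sum>k=1..N. a k * z l k)"
    proof (cases "l \<le> j")
      case True
      then show ?thesis using Utilde_ent[OF w j(1) l] by simp
    next
      case False
      then show ?thesis using kills[OF l] j(2) by simp
    qed
  qed
  also have "\<dots> = (\<Sum>k=1..N. a k * z j k)" unfolding sum_single[OF j(1)] by simp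
  finally show ?thesis by simp
qed

section \<open>The linearised hypothesis\<close>

text \<open>
  The Lie algebra of \<open>U\<close>. Its elements are functions of pairs, as required by the duality lemma.
\<close>

definition skew_upper :: "lie_type \<Rightarrow> nat \<Rightarrow> (nat \<times> nat \<Rightarrow> 'a::field) set" where
  "skew_upper T n = {z. (\<forall>i j. j \<le> i \<longrightarrow> z (i, j) = 0) \<and>
     (\<forall>i\<in>{1..msize T n}. \<forall>j\<in>{1..msize T n}. z (bar T n j, bar T n i) = - (form_sign T n i * form_sign T n j * z (i, j)))}"

text \<open>
  Applying the hypothesis to the Cayley transforms of all multiples of \<open>z\<close> removes the character:
  the multiple \<open>d z\<close> with \<open>d = - c / 2\<close> produces the value of \<open>\<theta>\<close> at \<open>c\<close> times the pairing with \<open>z\<close>.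
\<close>

lemma pairing_eq:
  fixes A B :: "'a::field mat"
  assumes two: "(2::'a) \<noteq> 0" and \<theta>: "nontrivial_character \<theta>"
    and A: "A \<in> VV T n" and B: "B \<in> VV T n"
    and agree: "\<forall>u \<in> Stab \<theta> T n (chr \<theta> T n A) \<inter> Stab \<theta> T n (chr \<theta> T n B). Psi \<theta> T n A u = Psi \<theta> T n B u"
    and z: "z \<in> skew_upper T n"
    and zA: "\<And>i j. i < j \<Longrightarrow> i \<in> {1..msize T n} \<Longrightarrow> j \<in> {1..msize T n} \<Longrightarrow> 
        (\<Sum>k=1..msize T n. ent A i k * z (j, k)) = 0"
    and zB: "\<And>i j. i < j \<Longrightarrow> i \<in> {1..msize T n} \<Longrightarrow> j \<in> {1..msize T n} \<Longrightarrow> 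
        (\<Sum>k=1..msize T n. ent B i k * z (j, k)) = 0"
  shows "(\<Sum>i=1..msize T n. \<Sum>k=1..msize T n. ent A i k * z (i, k)) = 
    (\<Sum>i=1..msize T n. \<Sum>k=1..msize T n. ent B i k * z (i, k))"
proof -
  let ?N = "msize T n"
  have "\<theta> (c * (\<Sum>i=1..?N. \<Sum>k=1..?N. ent A i k * z (i, k))) = \<theta> (c * (\<Sum>i=1..?N. \<Sum>k=1..?N. ent B i k * z (i, k)))" for c
  proof -
    define d where "d = - (c / 2)"
    obtain w where w: "w \<in> carrier (UU T n)"
      and cay: "\<And>i j. i \<in> {1..?N} \<Longrightarrow> j \<in> {1..?N} \<Longrightarrow> 
        ent w i j = (if i = j then 1 else 0) + d * z (i, j) + (\<Sum>k=1..?N. ent w i k * (d * z (k, j)))"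
      by (rule cayley[OF two, of "\<lambda>i j. d * z (i, j)" T n]) (use z in \<open>auto simp: skew_upper_def\<close>)
    note wU = UU_Utilde[OF w]
    have pair: "(\<Sum>k=1..?N. ent C i k * ent w j k) = ent C i j + 2 * d * (\<Sum>k=1..?N. ent C i k * z (j, k))"
      if zC: "\<And>i j. i < j \<Longrightarrow> i \<in> {1..?N} \<Longrightarrow> j \<in> {1..?N} \<Longrightarrow> (\<Sum>k=1..?N. ent C i k * z (j, k)) = 0"
        and ij: "i \<in> {1..?N}" "j \<in> {1..?N}" "i \<le> j" for C :: "'a mat" and i j
    proof -
      have s: "(\<Sum>k=1..?N. ent C i k * (d * z (j, k))) = d * (\<Sum>k=1..?N. ent C i k * z (j, k))" for j
        by (simp add: sum_distrib_left mult_ac)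
      have "(\<Sum>k=1..?N. ent C i k * ent w j k) = ent C i j + 2 * (\<Sum>k=1..?N. ent C i k * (d * z (j, k)))"
        by (rule cayley_pairing[where z = "\<lambda>i j. d * z (i, j)", OF wU cay _ ij(2,3)]) 
          (use zC ij(1) s in auto)
      then show ?thesis unfolding s by (simp add: mult.assoc)
    qed
    have psi: "inv\<^bsub>UU T n\<^esub> w \<in> Stab \<theta> T n (chr \<theta> T n C)"
      "Psi \<theta> T n C (inv\<^bsub>UU T n\<^esub> w) = \<theta> (c * (\<Sum>i=1..?N. \<Sum>k=1..?N. ent C i k * z (i, k)))"
      if C: "C \<in> VV T n" 
        and zC: "\<And>i j. i < j \<Longrightarrow> i \<in> {1..?N} \<Longrightarrow> j \<in> {1..?N} \<Longrightarrow> (\<Sum>k=1..?N. ent C i k * z (j, k)) = 0" for C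
    proof -
      have fixed: "(\<Sum>k=1..?N. ent C i k * ent w j k) = ent C i j" if "(i, j) \<in> Pos T n" for i j
        using pair[OF zC] zC[of i j] Pos_bounds[OF that] by simp
      have "(\<Sum>i=1..?N. \<Sum>j=1..?N. ent C i j * ent w i j) = (\<Sum>i=1..?N. 2 * d * (\<Sum>k=1..?N. ent C i k * z (i, k)))"
      proof (intro sum.cong refl)
        fix i assume i: "i \<in> {1..?N}"
        have "(i, i) \<notin> Pos T n" by (simp add: Pos_iff)
        then have "ent C i i = 0" using C i by (simp add: VV_iff)
        then show "(\<Sum>j=1..?N. ent C i j * ent w i j) = 2 * d * (\<Sum>k=1..?N. ent C i k * z (i, k))"
          using pair[OF zC i i] by simp
      qed
      also have "\<dots> = 2 * d * (\<Sum>i=1..?N. \<Sum>k=1..?N. ent C i k * z (i, k))" by (simp add: sum_distrib_left)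
      also have "2 * d = - c" using two by (simp add: d_def)
      finally show "Psi \<theta> T n C (inv\<^bsub>UU T n\<^esub> w) = \<theta> (c * (\<Sum>i=1..?N. \<Sum>k=1..?N. ent C i k * z (i, k)))"
        by (simp add: stab_Psi_inverse(2)[OF \<theta> C w fixed])
      show "inv\<^bsub>UU T n\<^esub> w \<in> Stab \<theta> T n (chr \<theta> T n C)"
        by (rule stab_Psi_inverse(1)[OF \<theta> C w fixed])
    qed
    show ?thesis using agree psi[OF A zA] psi[OF B zB] by simp
  qed
  then show ?thesis by (rule character_separates[OF \<theta>])
qed

lemma sum_SIGMA_times_bool:
  fixes F :: "nat \<Rightarrow> nat \<Rightarrow> bool \<Rightarrow> 'a::comm_monoid_add"
  shows "(\<Sum>((i, k), X)\<in>(SIGMA i:{1..N}. {..<i}) \<times> UNIV. F i k X) 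
    = (\<Sum>i=1..N. \<Sum>k<i. F i k True + F i k False)"
proof -
  have "(\<Sum>((i, k), X)\<in>(SIGMA i:{1..N}. {..<i}) \<times> UNIV. F i k X) 
     = (\<Sum>(i, k)\<in>(SIGMA i:{1..N}. {..<i}). \<Sum>X\<in>UNIV. F i k X)"
    by (subst sum.cartesian_product[symmetric]) (intro sum.cong refl, auto)
  also have "\<dots> = (\<Sum>i=1..N. \<Sum>k<i. \<Sum>X\<in>UNIV. F i k X)"
    by (subst sum.Sigma) auto
  finally show ?thesis by (simp add: UNIV_bool add.commute)
qed

text \<open>
  The test element has an entry \<open>1\<close> at \<open>(i, j)\<close> and the entry at \<open>(bar j, bar i)\<close> that skewness then
  prescribes. Written as a difference, this remains correct when both positions coincide.
\<close>

lemma skew_test: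
  fixes D :: "nat \<Rightarrow> nat \<Rightarrow> 'a::field"
  assumes D: "\<And>z. z \<in> skew_upper T n \<Longrightarrow> (\<Sum>i=1..msize T n. \<Sum>j=1..msize T n. D i j * z (i, j)) = 0"
    and ij: "1 \<le> i" "i < j" "j \<le> msize T n"
  shows "D i j = form_sign T n i * form_sign T n j * D (bar T n j) (bar T n i)"
proof -
  let ?N = "msize T n" and ?s = "form_sign T n i * form_sign T n j :: 'a"
  define z :: "nat \<times> nat \<Rightarrow> 'a" where "z p = (if fst p = i \<and> snd p = j then 1 else 0)
    - (if fst p = bar T n j \<and> snd p = bar T n i then ?s else 0)" for p
  have iN: "i \<in> {1..?N}" and jN: "j \<in> {1..?N}" using ij by auto
  have lt: "bar T n j < bar T n i" using ij by (auto simp: bar_def)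
  have ss: "form_sign T n (bar T n j) * form_sign T n (bar T n i) = ?s"
    using ij by (auto simp: form_sign_def bar_def msize_def split: if_splits)
  have "z \<in> skew_upper T n"
    unfolding skew_upper_def
  proof (intro CollectI conjI allI impI ballI)
    fix a b :: nat assume "b \<le> a"
    then have "\<not> (a = i \<and> b = j)" "\<not> (a = bar T n j \<and> b = bar T n i)" using ij lt by auto
    then show "z (a, b) = 0" unfolding z_def fst_conv snd_conv by (simp only: if_False diff_0_right)
  next
    fix a b assume a: "a \<in> {1..?N}" and b: "b \<in> {1..?N}"
    have e: "bar T n b = i \<and> bar T n a = j \<longleftrightarrow> a = bar T n j \<and> b = bar T n i"
      "bar T n b = bar T n j \<and> bar T n a = bar T n i \<longleftrightarrow> a = i \<and> b = j"
      using a b ij by (auto simp: bar_def)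
    have signs: "(if Y then 1 else 0) - (if X then s else 0) = - (q * ((if X then 1 else 0) - (if Y then s else 0)))"
      if "X \<or> Y \<longrightarrow> q = s" "s * s = 1" for X Y and q s :: 'a
      using that by (cases X; cases Y) (simp_all add: right_diff_distrib)
    show "z (bar T n b, bar T n a) = - (form_sign T n a * form_sign T n b * z (a, b))"
      unfolding z_def fst_conv snd_conv e
    proof (rule signs)
      show "a = i \<and> b = j \<or> a = bar T n j \<and> b = bar T n i \<longrightarrow> form_sign T n a * form_sign T n b = ?s"
        using ss by blast
      show "?s * ?s = 1" by (simp add: form_sign_def)
    qed
  qed
  then have "0 = (\<Sum>a=1..?N. \<Sum>b=1..?N. D a b * z (a, b))" using D by simp
  also have "\<dots> = (\<Sum>a=1..?N. \<Sum>b=1..?N. (if a = i \<and> b = j then 1 else 0) * D a b 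
     - (if a = bar T n j \<and> b = bar T n i then ?s else 0) * D a b)"
    unfolding z_def fst_conv snd_conv right_diff_distrib by (simp only: mult.commute)
  also have "\<dots> = (\<Sum>a=1..?N. (if True \<and> a = i then 1 else 0) * D a j 
     - (if True \<and> a = bar T n j then ?s else 0) * D a (bar T n i))"
    unfolding sum_subtractf sum_single[OF jN] sum_single[OF bar_in[OF iN]] 
    by (intro arg_cong2[where f = "(-)"] sum.cong refl) auto
  also have "\<dots> = D i j - ?s * D (bar T n j) (bar T n i)"
    unfolding sum_subtractf sum_single[OF iN] sum_single[OF bar_in[OF jN]] by simp
  finally show ?thesis by simp
qed

text \<open>
  Entries outside the matrix are taken to be zero, so that sums over rows may start at index 0.
\<close>

definition entries :: "nat \<Rightarrow> 'a::zero mat \<Rightarrow> nat \<Rightarrow> nat \<Rightarrow> 'a" where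
  "entries N A i j = (if i \<in> {1..N} \<and> j \<in> {1..N} then ent A i j else 0)"

text \<open>
  The linear forms of the duality lemma are indexed by pairs of rows \<open>k < i\<close> and a Boolean that selects
  \<open>A\<close> or \<open>B\<close>; their coefficients are the entries of the two lower triangular matrices.
\<close>

lemma skew_difference:
  fixes A B :: "'a::field mat"
  assumes two: "(2::'a) \<noteq> 0" and \<theta>: "nontrivial_character \<theta>"
    and A: "A \<in> VV T n" and B: "B \<in> VV T n"
    and agree: "\<forall>u \<in> Stab \<theta> T n (chr \<theta> T n A) \<inter> Stab \<theta> T n (chr \<theta> T n B). Psi \<theta> T n A u = Psi \<theta> T n B u"
  defines "a \<equiv> entries (msize T n) A" and "b \<equiv> entries (msize T n) B"
  shows "\<exists>l r D. (\<forall>i j. D i j = a i j - b i j + (\<Sum>k<i. l i k * a k j) - (\<Sum>k<i. r i k * b k j)) \<and>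
    (\<forall>i j. 1 \<le> i \<longrightarrow> i < j \<longrightarrow> j \<le> msize T n \<longrightarrow> D i j = form_sign T n i * form_sign T n j * D (bar T n j) (bar T n i))"
proof -
  let ?N = "msize T n"
  let ?I = "(SIGMA i:{1..?N}. {..<i}) \<times> (UNIV :: bool set)"
  define f :: "(nat \<times> nat) \<times> bool \<Rightarrow> (nat \<times> nat \<Rightarrow> 'a) \<Rightarrow> 'a" 
    where "f = (\<lambda>((i, k), X) z. \<Sum>j=1..?N. (if X then a else b) k j * z (i, j))"
  define g :: "(nat \<times> nat \<Rightarrow> 'a) \<Rightarrow> 'a" where "g = (\<lambda>z. \<Sum>i=1..?N. \<Sum>j=1..?N. (a i j - b i j) * z (i, j))"
  have "\<exists>c. \<forall>z\<in>skew_upper T n. g z = (\<Sum>p\<in>?I. c p * f p z)"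
  proof (rule combination_if_vanishes_on_common_kernel)
    show "finite ?I" by auto
    show "(\<lambda>p. v p + c * w p) \<in> skew_upper T n" if "v \<in> skew_upper T n" "w \<in> skew_upper T n" for v w c
      using that by (auto simp: skew_upper_def algebra_simps)
    show "f p (\<lambda>q. v q + c * w q) = f p v + c * f p w" for p v w c
      by (cases p) (auto simp: f_def sum.distrib sum_distrib_left algebra_simps)
    show "g (\<lambda>q. v q + c * w q) = g v + c * g w" for v w c
      by (simp add: g_def sum.distrib sum_distrib_left sum_subtractf algebra_simps)
    fix z assume z: "z \<in> skew_upper T n" and ker: "\<And>p. p \<in> ?I \<Longrightarrow> f p z = 0"
    have ab: "a i k = ent A i k" "b i k = ent B i k" if "i \<in> {1..?N}" "k \<in> {1..?N}" for i k
      using that by (auto simp: a_def b_def entries_def)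
    \<comment> \<open>the kernel conditions of \<open>pairing_eq\<close>, one for each index of a form\<close>
    have zA: "(\<Sum>k=1..?N. ent A i k * z (j, k)) = 0" and zB: "(\<Sum>k=1..?N. ent B i k * z (j, k)) = 0"
      if "i < j" "i \<in> {1..?N}" "j \<in> {1..?N}" for i j
      using ker[of "((j, i), True)"] ker[of "((j, i), False)"] that by (simp_all add: f_def ab)
    have "g z = (\<Sum>i=1..?N. \<Sum>j=1..?N. ent A i j * z (i, j)) - (\<Sum>i=1..?N. \<Sum>j=1..?N. ent B i j * z (i, j))"
      by (simp add: g_def ab left_diff_distrib sum_subtractf)
    then show "g z = 0" using pairing_eq[OF two \<theta> A B agree z zA zB] by simp
  qed
  then obtain c where c: "\<And>z. z \<in> skew_upper T n \<Longrightarrow> g z = (\<Sum>p\<in>?I. c p * f p z)" by blast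
  define l where "l i k = - c ((i, k), True)" for i k
  define r where "r i k = c ((i, k), False)" for i k
  define D where "D i j = a i j - b i j + (\<Sum>k<i. l i k * a k j) - (\<Sum>k<i. r i k * b k j)" for i j
  have "(\<Sum>i=1..?N. \<Sum>j=1..?N. D i j * z (i, j)) = 0" if z: "z \<in> skew_upper T n" for z
  proof -
    have "(\<Sum>p\<in>?I. c p * f p z) = (\<Sum>((i, k), X)\<in>?I. c ((i, k), X) * f ((i, k), X) z)"
      by (intro sum.cong) auto
    also have "\<dots> = (\<Sum>i=1..?N. \<Sum>k<i. c ((i, k), True) * f ((i, k), True) z + c ((i, k), False) * f ((i, k), False) z)"
      by (rule sum_SIGMA_times_bool)
    also have "\<dots> = (\<Sum>i=1..?N. \<Sum>k<i. \<Sum>j=1..?N. (r i k * b k j - l i k * a k j) * z (i, j))"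
      by (simp add: f_def l_def r_def sum_distrib_left sum.distrib[symmetric] algebra_simps)
    also have "\<dots> = (\<Sum>i=1..?N. \<Sum>j=1..?N. \<Sum>k<i. (r i k * b k j - l i k * a k j) * z (i, j))"
      by (intro sum.cong refl sum.swap)
    finally have "g z = \<dots>" using c[OF z] by simp
    then have "0 = g z - (\<Sum>i=1..?N. \<Sum>j=1..?N. \<Sum>k<i. (r i k * b k j - l i k * a k j) * z (i, j))" by simp
    also have "\<dots> = (\<Sum>i=1..?N. \<Sum>j=1..?N. D i j * z (i, j))"
      unfolding g_def sum_subtractf[symmetric] D_def sum_distrib_right[symmetric]
      by (intro sum.cong refl) (simp add: sum_subtractf algebra_simps)
    finally show ?thesis by simp
  qed
  then have "D i j = form_sign T n i * form_sign T n j * D (bar T n j) (bar T n i)" if "1 \<le> i" "i < j" "j \<le> ?N" for i j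
    using that by (rule skew_test)
  then show ?thesis by (intro exI[of _ l] exI[of _ r] exI[of _ D]) (simp add: D_def)
qed

section \<open>Main separation and core characters, row by row\<close>

lemma last_nonzero_entries_iff:
  assumes "A \<in> VV T n"
  shows "last_nonzero (entries (msize T n) A) i j \<longleftrightarrow> (i, j) \<in> main T n A"
proof
  assume l: "last_nonzero (entries (msize T n) A) i j"
  then have r: "i \<in> {1..msize T n}" "j \<in> {1..msize T n}" "ent A i j \<noteq> 0"
    by (auto simp: last_nonzero_def entries_def split: if_splits)
  then have "(i, j) \<in> Pos T n" using assms unfolding VV_iff by blast
  moreover have "ent A i k = 0" if "k \<in> {j<..msize T n}" for k
    using l r(1,2) that by (auto simp: last_nonzero_def entries_def)
  ultimately show "(i, j) \<in> main T n A" using r by (auto simp: main_def)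
next
  assume "(i, j) \<in> main T n A"
  then show "last_nonzero (entries (msize T n) A) i j"
    using Pos_bounds[of i j T n] by (auto simp: main_def last_nonzero_def entries_def)
qed

text \<open>
  The lower of two main conditions in one column would lie in the leg of the upper one.
\<close>

lemma main_separated_column:
  assumes supp: "supp T n A \<subseteq> Pcirc T n" and sep: "main_separated T n A"
    and "(i, j) \<in> main T n A" "(i', j) \<in> main T n A"
  shows "i = i'"
proof -
  have P: "(i, j) \<in> Pcirc T n" if "(i, j) \<in> main T n A" for i j
    using that supp Pos_bounds[of i j T n] by (auto simp: main_def supp_def)
  have "\<not> i < i'" if "(i, j) \<in> main T n A" "(i', j) \<in> main T n A" for i i'
  proof
    assume "i < i'"
    then have "(i', j) \<in> leg T n i j" using P[OF that(2)] by (auto simp: leg_def)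
    then have "(i', j) \<in> limb T n A" using that(1) by (auto simp: limb_def limb_circ_def)
    then show False using sep that(2) by (auto simp: main_separated_def)
  qed
  then show ?thesis using assms(3,4) by (meson linorder_cases)
qed

text \<open>
  The row of the arm of a main condition is zero, as the last nonzero entry of that row would be a
  main condition in the arm.
\<close>

lemma main_separated_row:
  assumes "A \<in> VV T n" "supp T n A \<subseteq> Pcirc T n" "main_separated T n A" "(i, j) \<in> main T n A"
  shows "entries (msize T n) A (bar T n j) k = 0"
proof (rule ccontr)
  let ?a = "entries (msize T n) A"
  assume nz: "?a (bar T n j) k \<noteq> 0"
  have "m \<le> msize T n" if "?a (bar T n j) m \<noteq> 0" for m
    using that by (auto simp: entries_def split: if_splits)
  then have "\<exists>m\<ge>k. last_nonzero ?a (bar T n j) m" 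
    by (rule last_nonzero_exists[where a = ?a and i = "bar T n j" and N = "msize T n", OF nz])
  then obtain m where "last_nonzero ?a (bar T n j) m" by blast
  then have m: "(bar T n j, m) \<in> main T n A" by (simp add: last_nonzero_entries_iff[OF assms(1)])
  then have "(bar T n j, m) \<in> Pcirc T n" 
    using assms(2) Pos_bounds[of "bar T n j" m T n] by (auto simp: main_def supp_def)
  then have "(bar T n j, m) \<in> arm T n i j" by (auto simp: arm_def)
  then have "(bar T n j, m) \<in> limb T n A" using assms(4) by (auto simp: limb_def limb_circ_def)
  then show False using assms(3) m by (auto simp: main_separated_def)
qed

text \<open>
  Minor and supplementary conditions lie in the left half of the matrix.
\<close>

lemma core_right_half:
  assumes "core_character T n A" "(i, j) \<in> supp T n A" "bar T n j < j"
  shows "(i, j) \<in> main T n A"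
proof -
  have nt: "\<not> j \<le> ntilde T n" using assms(3) by (auto simp: ntilde_def bar_def msize_def split: if_splits)
  have "(i, j) \<notin> minor T n A"
  proof
    assume "(i, j) \<in> minor T n A"
    then obtain m where m: "(i, m) \<in> r_main T n A" "j = bar T n m" by (auto simp: minor_def)
    then have "(i, m) \<in> Pos T n" "ntilde T n < m" by (auto simp: r_main_def main_def)
    then have "bar T n m \<le> ntilde T n" by (auto simp: ntilde_def bar_def msize_def)
    then show False using m(2) nt by simp
  qed
  moreover have "(i, j) \<notin> suppl T n A" using nt by (auto simp: suppl_def)
  ultimately show ?thesis using assms(1,2) by (auto simp: core_character_def core_def split: if_splits)
qed

section \<open>Row operations carried out by the subgroup attached to A\<close>

lemma Iset_Pos:
  assumes "(k, i) \<in> Iset T n A" shows "(k, i) \<in> Pos T n" "i \<le> n"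
proof -
  obtain b where "1 \<le> k" "k < i" "(i, b) \<in> Pos T n" using assms by (auto simp: Iset_def main_def)
  moreover from this show "i \<le> n" using Pos_bounds(4) by blast
  ultimately show "(k, i) \<in> Pos T n" by (auto simp: Pos_iff bar_def msize_def)
qed

lemma subgroup_U_I: "subgroup (U_I T n A) (UU T n)"
proof -
  have "(\<Union>r\<in>Iset T n A. root_subgroup T n r) \<subseteq> carrier (UU T n)"
    using root_elt_UU Iset_Pos by (fastforce simp: root_subgroup_def)
  from group.generate_is_subgroup[OF group_UU this] show ?thesis by (simp add: U_I_def)
qed

text \<open>
  The matrix form of the left action of the subgroup attached to \<open>A\<close>. Stated for matrices, it does
  not depend on the character \<open>\<theta>\<close>.
\<close>

definition row_reachable :: "lie_type \<Rightarrow> nat \<Rightarrow> 'a::field mat \<Rightarrow> 'a mat \<Rightarrow> 'a mat \<Rightarrow> bool" where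
  "row_reachable T n A M M' \<longleftrightarrow> (\<exists>g\<in>U_I T n A. proj T n (inv_tr T n g * M) = M')"

text \<open>
  A lower triangular factor on the left moves entries only downwards, and along with a position P
  contains all positions above it in the same column. So entries outside P never contribute to
  entries inside P.
\<close>

lemma proj_lower_mult:
  assumes w: "w \<in> carrier (Utilde (msize T n))" and M: "M \<in> carrier_mat (msize T n) (msize T n)"
  shows "proj T n (transpose_mat w * proj T n M) = proj T n (transpose_mat w * M)"
proof (rule eq_entI[OF proj_carrier proj_carrier])
  let ?N = "msize T n"
  note wc = Utilde_carrier_mat[OF w]
  have tc: "transpose_mat w \<in> carrier_mat ?N ?N" using wc by simp
  fix i j assume i: "i \<in> {1..?N}" and j: "j \<in> {1..?N}"
  have "ent (transpose_mat w * proj T n M) i j = ent (transpose_mat w * M) i j" if P: "(i, j) \<in> Pos T n"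
    unfolding ent_mult[OF tc proj_carrier i j] ent_mult[OF tc M i j]
  proof (intro sum.cong refl)
    fix k assume k: "k \<in> {1..?N}"
    show "ent (transpose_mat w) i k * ent (proj T n M) k j = ent (transpose_mat w) i k * ent M k j"
    proof (cases "k \<le> i")
      case True
      then have "(k, j) \<in> Pos T n" using P k by (auto simp: Pos_iff bar_def split: if_splits)
      then show ?thesis by (simp add: ent_proj[OF k j])
    next
      case False
      then show ?thesis using Utilde_ent[OF w k i] by (simp add: ent_transpose[OF wc i k])
    qed
  qed
  then show "ent (proj T n (transpose_mat w * proj T n M)) i j = ent (proj T n (transpose_mat w * M)) i j"
    by (simp add: ent_proj[OF i j])
qed

lemma row_reachable_refl:
  assumes "M \<in> VV T n"
  shows "row_reachable T n A M M"
proof -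
  let ?N = "msize T n"
  interpret U: group "UU T n :: 'a mat monoid" by (rule group_UU)
  have Mc: "M \<in> carrier_mat ?N ?N" using assms by (simp add: VV_iff)
  have "inv_tr T n (1\<^sub>m ?N) = (1\<^sub>m ?N :: 'a mat)" using U.inv_one by (simp add: inv_tr_def)
  then have "inv_tr T n (1\<^sub>m ?N) * M = M" using Mc by simp
  moreover have "proj T n M = M"
    using assms by (intro eq_entI[OF proj_carrier Mc]) (auto simp: ent_proj VV_iff)
  moreover have "1\<^sub>m ?N \<in> U_I T n A" using subgroup.one_closed[OF subgroup_U_I, of T n A] by simp
  ultimately show ?thesis unfolding row_reachable_def by (intro bexI[of _ "1\<^sub>m ?N"]) simp_all
qed

lemma row_reachable_trans:
  assumes M: "M \<in> carrier_mat (msize T n) (msize T n)" 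
    and "row_reachable T n A M M'" "row_reachable T n A M' (M'' :: 'a::field mat)"
  shows "row_reachable T n A M M''"
proof -
  let ?N = "msize T n"
  interpret U: group "UU T n :: 'a mat monoid" by (rule group_UU)
  interpret S: subgroup "U_I T n A" "UU T n :: 'a mat monoid" by (rule subgroup_U_I)
  obtain g h where g: "g \<in> U_I T n A" "proj T n (inv_tr T n g * M) = M'"
    and h: "h \<in> U_I T n A" "proj T n (inv_tr T n h * M') = M''"
    using assms by (auto simp: row_reachable_def)
  have gh: "g \<in> carrier (UU T n)" "h \<in> carrier (UU T n)" using g h S.subset by auto
  then have inv: "inv\<^bsub>UU T n\<^esub> g \<in> carrier (UU T n)" "inv\<^bsub>UU T n\<^esub> h \<in> carrier (UU T n)" by auto
  then have ic: "inv\<^bsub>UU T n\<^esub> g \<in> carrier_mat ?N ?N" "inv\<^bsub>UU T n\<^esub> h \<in> carrier_mat ?N ?N"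
    using UU_Utilde Utilde_carrier_mat by blast+
  then have tc: "inv_tr T n g \<in> carrier_mat ?N ?N" "inv_tr T n h \<in> carrier_mat ?N ?N"
    by (simp_all add: inv_tr_def)
  have "inv\<^bsub>UU T n\<^esub> (h * g) = inv\<^bsub>UU T n\<^esub> g * inv\<^bsub>UU T n\<^esub> h"
    using U.inv_mult_group[OF gh(2,1)] by simp
  then have "inv_tr T n (h * g) = inv_tr T n h * inv_tr T n g"
    unfolding inv_tr_def using transpose_mult[OF ic] by simp
  then have "proj T n (inv_tr T n (h * g) * M) = proj T n (inv_tr T n h * (inv_tr T n g * M))"
    by (simp add: assoc_mult_mat[OF tc(2,1) M])
  also have "\<dots> = proj T n (inv_tr T n h * M')"
    unfolding g(2)[symmetric] inv_tr_def[of T n h]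
    by (rule proj_lower_mult[symmetric, OF UU_Utilde[OF inv(2)] mult_carrier_mat[OF tc(1) M]])
  finally have "proj T n (inv_tr T n (h * g) * M) = M''" using h(2) by simp
  moreover have "h * g \<in> U_I T n A" using S.m_closed[OF h(1) g(1)] by simp
  ultimately show ?thesis by (auto simp: row_reachable_def)
qed

text \<open>
  The inverse of the root element is used, because its inverse transpose is just the transpose of the
  root element, which adds \<open>\<alpha>\<close> times row \<open>k\<close> to row \<open>i\<close>.
\<close>

lemma row_reachable_row_operation:
  fixes M :: "'a::field mat"
  assumes ki: "(k, i) \<in> Iset T n A" and M: "M \<in> carrier_mat (msize T n) (msize T n)" and M': "M' \<in> VV T n"
    and op: "\<And>a b. (a, b) \<in> Pos T n \<Longrightarrow> ent M' a b = ent M a b + (if a = i then \<alpha> * ent M k b else 0)"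
  shows "row_reachable T n A M M'"
proof -
  let ?N = "msize T n" and ?x = "root_elt T n k i \<alpha>"
  interpret U: group "UU T n :: 'a mat monoid" by (rule group_UU)
  interpret S: subgroup "U_I T n A" "UU T n :: 'a mat monoid" by (rule subgroup_U_I)
  note P = Iset_Pos(1)[OF ki] and xc = root_elt_carrier[of T n k i \<alpha>]
  note b = Pos_bounds[OF P]
  have M'c: "M' \<in> carrier_mat ?N ?N" using M' by (simp add: VV_iff)
  have tc: "transpose_mat ?x \<in> carrier_mat ?N ?N" using xc by simp
  have "?x \<in> U_I T n A"
    unfolding U_I_def using ki by (intro generate.incl) (auto simp: root_subgroup_def)
  then have x: "?x \<in> carrier (UU T n)" "inv\<^bsub>UU T n\<^esub> ?x \<in> U_I T n A" using S.subset S.m_inv_closed by auto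
  have "inv_tr T n (inv\<^bsub>UU T n\<^esub> ?x) = transpose_mat ?x" using x(1) by (simp add: inv_tr_def)
  moreover have "proj T n (transpose_mat ?x * M) = M'"
  proof (rule eq_entI[OF proj_carrier M'c])
    fix a c assume a: "a \<in> {1..?N}" and c: "c \<in> {1..?N}"
    have "ent (transpose_mat ?x * M) a c = ent M' a c" if ac: "(a, c) \<in> Pos T n"
    proof -
      have "a \<noteq> bar T n k" using Pos_bounds(4)[OF ac] b Iset_Pos(2)[OF ki] by (auto simp: bar_def msize_def)
      then have dis: "a \<noteq> bar T n k \<or> i = bar T n k" by simp
      have "ent (transpose_mat ?x * M) a c = (\<Sum>m=1..?N. (if True \<and> m = a then 1 else 0) * ent M m c
          + (if a = i \<and> m = k then \<alpha> else 0) * ent M m c)"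
        unfolding ent_mult[OF tc M a c]
      proof (intro sum.cong refl)
        fix m assume m: "m \<in> {1..?N}"
        show "ent (transpose_mat ?x) a m * ent M m c = (if True \<and> m = a then 1 else 0) * ent M m c
          + (if a = i \<and> m = k then \<alpha> else 0) * ent M m c"
          unfolding ent_transpose[OF xc a m] ent_root_elt_column[OF P m a dis] by (simp add: distrib_right)
      qed
      also have "\<dots> = ent M' a c"
        unfolding sum.distrib sum_single[OF a] sum_single[OF b(5)] op[OF ac] by simp
      finally show ?thesis .
    qed
    then show "ent (proj T n (transpose_mat ?x * M)) a c = ent M' a c"
      using M' a c by (simp add: ent_proj VV_iff)
  qed
  ultimately show ?thesis using x(2) unfolding row_reachable_def by (intro bexI[of _ "inv\<^bsub>UU T n\<^esub> ?x"]) simp_all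
qed

text \<open>
  The coefficients are switched on one at a time, row by row from the bottom, so that the rows above
  the one being changed are still those of \<open>B\<close>: \<open>E t m\<close> contains all coefficients of the rows below \<open>t\<close>
  and those of row \<open>t\<close> in columns less than \<open>m\<close>.
\<close>

lemma row_reachable_combination:
  fixes A B :: "'a::field mat"
  assumes A: "A \<in> VV T n" and B: "B \<in> VV T n"
    and pattern: "\<And>i k. c i k \<noteq> 0 \<Longrightarrow> (k, i) \<in> Iset T n A"
    and comb: "\<And>i j. (i, j) \<in> Pos T n \<Longrightarrow> ent A i j = ent B i j + (\<Sum>k\<in>{1..<i}. c i k * ent B k j)"
  shows "row_reachable T n A B A"
proof -
  let ?N = "msize T n"
  define F where "F e = proj T n (mat ?N ?N (\<lambda>(r, s). ent B (r + 1) (s + 1) + 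
     (\<Sum>k\<in>{1..<r + 1}. e (r + 1) k * ent B k (s + 1))))" for e
  have FV: "F e \<in> VV T n" for e by (simp add: F_def proj_VV)
  then have Fc: "F e \<in> carrier_mat ?N ?N" for e by (simp add: VV_iff)
  have entF: "ent (F e) i j = ent B i j + (\<Sum>k\<in>{1..<i}. e i k * ent B k j)" if "(i, j) \<in> Pos T n" for e i j
  proof -
    note b = Pos_bounds(5,6)[OF that]
    show ?thesis unfolding F_def ent_proj[OF b] using that b by (auto simp: ent_def)
  qed
  define E where "E t m i k = (if t < i \<or> (i = t \<and> k < m) then c i k else 0)" for t m i k :: nat
  have one_step: "row_reachable T n A (F (E t m)) (F (E t (Suc m)))" if m: "1 \<le> m" "m < t" for t m
  proof (cases "c t m = 0")
    case True
    then have "E t (Suc m) = E t m" by (intro ext) (auto simp: E_def less_Suc_eq)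
    then show ?thesis using row_reachable_refl[OF FV] by simp
  next
    case False
    show ?thesis
    proof (rule row_reachable_row_operation[OF pattern[OF False] Fc FV])
      fix i j assume P: "(i, j) \<in> Pos T n"
      show "ent (F (E t (Suc m))) i j = ent (F (E t m)) i j + (if i = t then c t m * ent (F (E t m)) m j else 0)"
      proof (cases "i = t")
        case False
        then have "E t (Suc m) i k = E t m i k" for k by (auto simp: E_def)
        then show ?thesis using False by (simp add: entF[OF P])
      next
        case True
        then have "(m, j) \<in> Pos T n" using P m by (auto simp: Pos_iff bar_def split: if_splits)
        then have "ent (F (E t m)) m j = ent B m j" using m by (simp add: entF E_def)
        moreover have "(\<Sum>k\<in>{1..<t}. E t (Suc m) t k * ent B k j) = 
            (\<Sum>k\<in>{1..<t}. E t m t k * ent B k j + (if k = m then c t m * ent B m j else 0))"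
          by (intro sum.cong refl) (auto simp: E_def less_Suc_eq)
        moreover have "(t, j) \<in> Pos T n" using P True by simp
        ultimately show ?thesis using True m by (simp add: entF sum.distrib)
      qed
    qed
  qed
  have row: "row_reachable T n A (F (E t 1)) (F (E t m))" if "1 \<le> m" "m \<le> t" for t m
    using that
  proof (induction m rule: dec_induct)
    case base
    show ?case by (rule row_reachable_refl[OF FV])
  next
    case (step m)
    then have "row_reachable T n A (F (E t 1)) (F (E t m))" and "m < t" by simp_all
    then show ?case using one_step[OF \<open>1 \<le> m\<close>] by (blast intro: row_reachable_trans[OF Fc])
  qed
  have cong: "F e = F e'" if "\<And>i k. (\<exists>j. (i, j) \<in> Pos T n) \<Longrightarrow> 1 \<le> k \<Longrightarrow> k < i \<Longrightarrow> e i k = e' i k" for e e'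
  proof (rule eq_entI[OF Fc Fc])
    fix i j assume ij: "i \<in> {1..?N}" "j \<in> {1..?N}"
    show "ent (F e) i j = ent (F e') i j"
    proof (cases "(i, j) \<in> Pos T n")
      case True
      then show ?thesis using that[of i] unfolding entF[OF True] by (intro arg_cong2[where f = "(+)"] sum.cong refl) auto
    next
      case False
      then show ?thesis using FV ij by (simp add: VV_iff)
    qed
  qed
  have all: "row_reachable T n A (F (E t 1)) (F (E 0 1))" for t
  proof (induction t)
    case 0
    show ?case by (rule row_reachable_refl[OF FV])
  next
    case (Suc t)
    have "F (E (Suc t) (Suc t)) = F (E t 1)" by (rule cong) (auto simp: E_def)
    then show ?case using row_reachable_trans[OF Fc row[of "Suc t" "Suc t"]] Suc.IH by simp
  qed
  have "B = F (E ?N 1)"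
  proof (rule eq_entI[OF _ Fc])
    fix i j assume ij: "i \<in> {1..?N}" "j \<in> {1..?N}"
    show "ent B i j = ent (F (E ?N 1)) i j"
    proof (cases "(i, j) \<in> Pos T n")
      case True
      then show ?thesis using ij by (simp add: entF E_def)
    next
      case False
      then show ?thesis using FV B ij by (simp add: VV_iff)
    qed
  qed (use B in \<open>simp add: VV_iff\<close>)
  moreover have "A = F (E 0 1)"
  proof (rule eq_entI[OF _ Fc])
    fix i j assume ij: "i \<in> {1..?N}" "j \<in> {1..?N}"
    show "ent A i j = ent (F (E 0 1)) i j"
    proof (cases "(i, j) \<in> Pos T n")
      case True
      then show ?thesis using ij by (simp add: entF E_def comb)
    next
      case False
      then show ?thesis using FV A ij by (simp add: VV_iff)
    qed
  qed (use A in \<open>simp add: VV_iff\<close>)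
  ultimately show ?thesis using all[of ?N] by simp
qed

section \<open>Characters whose linear characters agree on the common stabiliser\<close>

theorem theorem6p16:
  fixes p k n :: nat
    and T :: lie_type
    and \<theta> :: "'a::{field, finite} \<Rightarrow> complex"
    and A B :: "'a mat"
  assumes "prime p" and "odd p" and "CARD('a) = p ^ k"
    and "n \<ge> 1"
    and "nontrivial_character \<theta>"
    and "A \<in> VV T n" and "B \<in> VV T n"
    and "main_separated T n A" and "main_separated T n B"
    and "supp T n A \<subseteq> Pcirc T n" and "supp T n B \<subseteq> Pcirc T n"
    and "core_character T n A"
    and "\<forall>u \<in> Stab \<theta> T n (chr \<theta> T n A) \<inter> Stab \<theta> T n (chr \<theta> T n B).
           Psi \<theta> T n A u = Psi \<theta> T n B u"
  shows "\<exists>g \<in> U_I T n A. lact \<theta> T n g (chr \<theta> T n B) = chr \<theta> T n A"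
proof -
  let ?N = "msize T n"
  let ?a = "entries ?N A" and ?b = "entries ?N B"
  note A = assms(6) and B = assms(7)
  have two: "(2::'a) \<noteq> 0" using assms(2,3) by (intro two_neq_zero) simp
  obtain l r D where
    D: "\<forall>i j. D i j = ?a i j - ?b i j + (\<Sum>k<i. l i k * ?a k j) - (\<Sum>k<i. r i k * ?b k j)" and
    mirror: "\<forall>i j. 1 \<le> i \<longrightarrow> i < j \<longrightarrow> j \<le> ?N \<longrightarrow> D i j = form_sign T n i * form_sign T n j * D (bar T n j) (bar T n i)"
    using skew_difference[OF two assms(5) A B assms(13)] by (elim exE conjE)
  have supp: "1 \<le> i \<and> i < j \<and> j < bar T n i"
    if "entries ?N C i j \<noteq> 0" "supp T n C \<subseteq> Pcirc T n" for C :: "'a mat" and i j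
    using that by (force simp: entries_def supp_def Pcirc_def split: if_splits)
  note last_iff = last_nonzero_entries_iff[OF A] last_nonzero_entries_iff[OF B]
  have "\<exists>c. (\<forall>i k. c i k \<noteq> 0 \<longrightarrow> k < i \<and> (\<exists>m m'. last_nonzero ?a k m \<and> last_nonzero ?a i m' \<and> m < m')) \<and>
       (\<forall>i j. i < j \<longrightarrow> ?a i j = ?b i j + (\<Sum>k<i. c i k * ?b k j))"
  proof (rule row_equivalence[where N = ?N and mir = "bar T n" and D = D and l = l and r = r 
        and s = "\<lambda>i j. form_sign T n i * form_sign T n j"])
    show "bar T n i = ?N + 1 - i" for i by (simp add: bar_def)
    show "1 \<le> i \<and> i < j \<and> j < bar T n i" if "?a i j \<noteq> 0" for i j using supp[OF that assms(10)] .
    show "1 \<le> i \<and> i < j \<and> j < bar T n i" if "?b i j \<noteq> 0" for i j using supp[OF that assms(11)] .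
    show "i = i'" if "last_nonzero ?a i j" "last_nonzero ?a i' j" for i i' j
      using main_separated_column[OF assms(10,8)] that last_iff by blast
    show "i = i'" if "last_nonzero ?b i j" "last_nonzero ?b i' j" for i i' j
      using main_separated_column[OF assms(11,9)] that last_iff by blast
    show "?a (bar T n j) k = 0" if "last_nonzero ?a i j" for i j k
      using main_separated_row[OF A assms(10,8)] that last_iff by blast
    show "?b (bar T n j) k = 0" if "last_nonzero ?b i j" for i j k
      using main_separated_row[OF B assms(11,9)] that last_iff by blast
    show "last_nonzero ?a i j" if "?a i j \<noteq> 0" "bar T n j < j" for i j
    proof -
      have "(i, j) \<in> supp T n A" using that(1) by (auto simp: entries_def supp_def split: if_splits)
      then show ?thesis using core_right_half[OF assms(12) _ that(2)] last_iff by blast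
    qed
    show "D i j = ?a i j - ?b i j + (\<Sum>k<i. l i k * ?a k j) - (\<Sum>k<i. r i k * ?b k j)" for i j
      using D by blast
    show "D i j = form_sign T n i * form_sign T n j * D (bar T n j) (bar T n i)" if "1 \<le> i" "i < j" "j \<le> ?N" for i j
      using mirror that by blast
  qed
  then obtain c where pattern: "\<And>i k. c i k \<noteq> 0 \<Longrightarrow> k < i \<and> (\<exists>m m'. last_nonzero ?a k m \<and> last_nonzero ?a i m' \<and> m < m')"
    and comb: "\<And>i j. i < j \<Longrightarrow> ?a i j = ?b i j + (\<Sum>k<i. c i k * ?b k j)"
    by blast
  have "row_reachable T n A B A"
  proof (rule row_reachable_combination[OF A B])
    show "(k, i) \<in> Iset T n A" if ck: "c i k \<noteq> 0" for i k
    proof -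
      obtain m m' where m: "k < i" "(k, m) \<in> main T n A" "(i, m') \<in> main T n A" "m < m'"
        using pattern[OF ck] last_iff by blast
      then have "(k, m) \<in> Pos T n" "(i, m') \<in> Pos T n" by (auto simp: main_def)
      then have "1 \<le> k" "i \<le> ?N" using Pos_bounds(1)[of k m T n] Pos_bounds(5)[of i m' T n] by auto
      then show ?thesis using m by (auto simp: Iset_def)
    qed
    fix i j assume P: "(i, j) \<in> Pos T n"
    note b = Pos_bounds[OF P]
    have "(\<Sum>k<i. c i k * ?b k j) = (\<Sum>k\<in>{1..<i}. c i k * ?b k j)"
      by (rule sum.mono_neutral_right) (auto simp: entries_def)
    also have "\<dots> = (\<Sum>k\<in>{1..<i}. c i k * ent B k j)"
      using b by (intro sum.cong refl) (auto simp: entries_def)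
    finally show "ent A i j = ent B i j + (\<Sum>k\<in>{1..<i}. c i k * ent B k j)"
      using comb[OF b(2)] b(5,6) by (simp add: entries_def)
  qed
  then show ?thesis by (auto simp: row_reachable_def lact_def rep_chr[OF assms(5) B])
qed

end
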